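(* Let $\mathcal{A}$ be a von Neumann algebra. A partial ideal $\pi$ of $\mathcal{A}$ arises from a total ideal of $\mathcal{A}$ (that is, $\pi = \pi_I$ for some total ideal $I$ of $\mathcal{A}$) if and only if $\pi$ is an invariant partial ideal. Consequently, the map $I \longmapsto \pi_I$ is a bijective correspondence between the total ideals of $\mathcal{A}$ and the invariant partial ideals of $\mathcal{A}$.
   Context: All algebras and subalgebras are unital (subalgebras contain the unit of the ambient algebra). Let $\mathcal{A}$ be a von Neumann algebra. A total ideal of $\mathcal{A}$ is an ultraweakly closed, two-sided ideal of $\mathcal{A}$. A partial ideal of $\mathcal{A}$ is a map $\pi$ that assigns to each commutative sub-von-Neumann-algebra $V$ of $\mathcal{A}$ an ultraweakly closed ideal $\pi(V)$ of $V$ such that $\pi(V) = \pi(V') \cap V$ whenever $V \subset V'$ are commutative sub-von-Neumann-algebras of $\mathcal{A}$. For a unitary $u \in \mathcal{A}$, $\mathrm{Ad}_u : \mathcal{A} \to \mathcal{A}$ denotes the inner automorphism $a \mapsto u a u^*$. An invariant partial ideal of $\mathcal{A}$ is a partial ideal $\pi$ of $\mathcal{A}$ such that $\mathrm{Ad}_u(\pi(V)) = \pi(\mathrm{Ad}_u(V))$ for each commutative sub-von-Neumann-algebra $V \subset \mathcal{A}$ and each unitary $u \in \mathcal{A}$. For a total ideal $I$ of $\mathcal{A}$, $\pi_I$ denotes the partial ideal given by $\pi_I(V) = I \cap V$ for each commutative sub-von-Neumann-algebra $V$ of $\mathcal{A}$. *)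

theory Defs
  imports "HOL-Analysis.Analysis"
begin

section \<open>Complex Hilbert spaces\<close>

text \<open>
  A complex inner product space is a real one (giving norm, metric and topology) with a compatible
  complex structure.  The form is linear in its first argument; positive definiteness is
  inherited from \<^class>\<open>real_inner\<close> through the last axiom.
\<close>

class complex_inner_space = real_inner +
  fixes scaleC :: "complex \<Rightarrow> 'a \<Rightarrow> 'a"  (infixr \<open>*\<^sub>C\<close> 75)
    and cinner :: "'a \<Rightarrow> 'a \<Rightarrow> complex"
  assumes scaleC_add_right: "c *\<^sub>C (x + y) = c *\<^sub>C x + c *\<^sub>C y"
    and scaleC_add_left: "(c + d) *\<^sub>C x = c *\<^sub>C x + d *\<^sub>C x"
    and scaleC_scaleC: "c *\<^sub>C d *\<^sub>C x = (c * d) *\<^sub>C x"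
    and scaleC_of_real: "complex_of_real r *\<^sub>C x = r *\<^sub>R x"
    and cinner_commute: "cinner x y = cnj (cinner y x)"
    and cinner_add_left: "cinner (x + y) z = cinner x z + cinner y z"
    and cinner_scaleC_left: "cinner (c *\<^sub>C x) y = c * cinner x y"
    and inner_eq_Re_cinner: "inner x y = Re (cinner x y)"

class complex_hilbert_space = complex_inner_space + complete_space

instantiation complex :: complex_hilbert_space
begin

definition scaleC_complex :: "complex \<Rightarrow> complex \<Rightarrow> complex"
  where "scaleC_complex c x = c * x"

definition cinner_complex :: "complex \<Rightarrow> complex \<Rightarrow> complex"
  where "cinner_complex x y = x * cnj y"

instance
  by standard
    (auto simp: scaleC_complex_def cinner_complex_def inner_complex_def scaleR_conv_of_real
      algebra_simps)

end

lemma norm_scaleC: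
  fixes x :: "'h::complex_inner_space"
  shows "norm (c *\<^sub>C x) = cmod c * norm x"
proof -
  have *: "complex_of_real ((norm z)\<^sup>2) = cinner z z" for z :: 'h
  proof (rule complex_eqI)
    show "Re (complex_of_real ((norm z)\<^sup>2)) = Re (cinner z z)"
      by (simp add: power2_norm_eq_inner inner_eq_Re_cinner)
    show "Im (complex_of_real ((norm z)\<^sup>2)) = Im (cinner z z)"
      using arg_cong[OF cinner_commute[of z z], of Im] by simp
  qed
  have "cinner (c *\<^sub>C x) (c *\<^sub>C x) = c * cnj (cinner (c *\<^sub>C x) x)"
    by (metis cinner_commute cinner_scaleC_left)
  also have "\<dots> = (c * cnj c) * cinner x x"
    by (metis cinner_commute cinner_scaleC_left complex_cnj_mult mult.assoc)
  also have "\<dots> = complex_of_real ((cmod c * norm x)\<^sup>2)"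
    by (simp add: complex_norm_square[symmetric] power_mult_distrib flip: *)
  finally have "(norm (c *\<^sub>C x))\<^sup>2 = (cmod c * norm x)\<^sup>2"
    by (metis * of_real_eq_iff)
  then show ?thesis
    by (simp add: power2_eq_iff_nonneg)
qed

lemma scaleC_scaleR:
  fixes x :: "'h::complex_inner_space"
  shows "c *\<^sub>C (r *\<^sub>R x) = r *\<^sub>R (c *\<^sub>C x)"
  by (metis mult.commute scaleC_of_real scaleC_scaleC)

lemma bounded_linear_scaleC:
  "bounded_linear (\<lambda>x::'h::complex_inner_space. c *\<^sub>C x)"
  by (rule bounded_linear_intro[where K = "cmod c"])
    (auto simp: scaleC_add_right scaleC_scaleR norm_scaleC)


section \<open>Bounded operators\<close>

text \<open>
  The type \<^typ>\<open>'h \<Rightarrow>\<^sub>L 'h\<close> consists of the bounded real-linear maps, so B(H) is the following subset.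
\<close>

definition bounded_ops :: "('h::complex_hilbert_space \<Rightarrow>\<^sub>L 'h) set"
  where "bounded_ops = {a. \<forall>c x. blinfun_apply a (c *\<^sub>C x) = c *\<^sub>C blinfun_apply a x}"

lift_definition scale_op ::
    "complex \<Rightarrow> ('h::complex_hilbert_space \<Rightarrow>\<^sub>L 'h) \<Rightarrow> ('h \<Rightarrow>\<^sub>L 'h)"
  is "\<lambda>c f x. c *\<^sub>C f x"
  by (rule bounded_linear_compose[OF bounded_linear_scaleC])

definition adj :: "('h::complex_hilbert_space \<Rightarrow>\<^sub>L 'h) \<Rightarrow> ('h \<Rightarrow>\<^sub>L 'h)"
  where "adj a = (THE b. \<forall>x y. cinner (blinfun_apply a x) y = cinner x (blinfun_apply b y))"

text \<open>
  The coarsest topology on B(H) making all functionals in \<open>\<Phi>\<close> continuous.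
\<close>

definition op_topology ::
    "(('h::complex_hilbert_space \<Rightarrow>\<^sub>L 'h) \<Rightarrow> complex) set \<Rightarrow> ('h \<Rightarrow>\<^sub>L 'h) topology"
  where "op_topology \<Phi> =
    topology_generated_by (insert bounded_ops {{a \<in> bounded_ops. \<phi> a \<in> U} | \<phi> U. \<phi> \<in> \<Phi> \<and> open U})"

definition weak_op_topology :: "('h::complex_hilbert_space \<Rightarrow>\<^sub>L 'h) topology"
  where "weak_op_topology = op_topology {\<lambda>a. cinner (blinfun_apply a x) y | x y. True}"

definition ultraweak_topology :: "('h::complex_hilbert_space \<Rightarrow>\<^sub>L 'h) topology"
  where "ultraweak_topology = op_topology
    {\<lambda>a. \<Sum>n. cinner (blinfun_apply a (x n)) (y n) | x y :: nat \<Rightarrow> 'h.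
      summable (\<lambda>n. (norm (x n))\<^sup>2) \<and> summable (\<lambda>n. (norm (y n))\<^sup>2)}"


section \<open>Von Neumann algebras and their ideals\<close>

definition von_neumann_algebra :: "('h::complex_hilbert_space \<Rightarrow>\<^sub>L 'h) set \<Rightarrow> bool"
  where "von_neumann_algebra A \<longleftrightarrow>
    A \<subseteq> bounded_ops \<and>
    id_blinfun \<in> A \<and>
    (\<forall>a\<in>A. \<forall>b\<in>A. a + b \<in> A) \<and>
    (\<forall>c. \<forall>a\<in>A. scale_op c a \<in> A) \<and>
    (\<forall>a\<in>A. \<forall>b\<in>A. a o\<^sub>L b \<in> A) \<and>
    (\<forall>a\<in>A. adj a \<in> A) \<and>
    closedin weak_op_topology A"

definition comm_subalgebras ::
    "('h::complex_hilbert_space \<Rightarrow>\<^sub>L 'h) set \<Rightarrow> ('h \<Rightarrow>\<^sub>L 'h) set set"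
  where "comm_subalgebras A =
    {V. von_neumann_algebra V \<and> V \<subseteq> A \<and> (\<forall>a\<in>V. \<forall>b\<in>V. a o\<^sub>L b = b o\<^sub>L a)}"

definition two_sided_ideal ::
    "('h::complex_hilbert_space \<Rightarrow>\<^sub>L 'h) set \<Rightarrow> ('h \<Rightarrow>\<^sub>L 'h) set \<Rightarrow> bool"
  where "two_sided_ideal A I \<longleftrightarrow>
    I \<subseteq> A \<and>
    0 \<in> I \<and>
    (\<forall>x\<in>I. \<forall>y\<in>I. x + y \<in> I) \<and>
    (\<forall>c. \<forall>x\<in>I. scale_op c x \<in> I) \<and>
    (\<forall>a\<in>A. \<forall>x\<in>I. a o\<^sub>L x \<in> I \<and> x o\<^sub>L a \<in> I)"

definition total_ideal ::
    "('h::complex_hilbert_space \<Rightarrow>\<^sub>L 'h) set \<Rightarrow> ('h \<Rightarrow>\<^sub>L 'h) set \<Rightarrow> bool"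
  where "total_ideal A I \<longleftrightarrow> two_sided_ideal A I \<and> closedin ultraweak_topology I"

text \<open>
  Maps defined on the commutative sub-von-Neumann-algebras are represented by extensional
  functions, so that equality of such maps is equality in HOL.
\<close>

definition partial_ideal ::
    "('h::complex_hilbert_space \<Rightarrow>\<^sub>L 'h) set \<Rightarrow> (('h \<Rightarrow>\<^sub>L 'h) set \<Rightarrow> ('h \<Rightarrow>\<^sub>L 'h) set) \<Rightarrow> bool"
  where "partial_ideal A \<pi> \<longleftrightarrow>
    \<pi> \<in> (\<Pi>\<^sub>E V \<in> comm_subalgebras A. {J. two_sided_ideal V J \<and> closedin ultraweak_topology J}) \<and>
    (\<forall>V \<in> comm_subalgebras A. \<forall>V' \<in> comm_subalgebras A. V \<subseteq> V' \<longrightarrow> \<pi> V = \<pi> V' \<inter> V)"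

definition unitary :: "('h::complex_hilbert_space \<Rightarrow>\<^sub>L 'h) \<Rightarrow> bool"
  where "unitary u \<longleftrightarrow> u o\<^sub>L adj u = id_blinfun \<and> adj u o\<^sub>L u = id_blinfun"

definition Ad ::
    "('h::complex_hilbert_space \<Rightarrow>\<^sub>L 'h) \<Rightarrow> ('h \<Rightarrow>\<^sub>L 'h) \<Rightarrow> ('h \<Rightarrow>\<^sub>L 'h)"
  where "Ad u a = u o\<^sub>L a o\<^sub>L adj u"

definition invariant_partial_ideal ::
    "('h::complex_hilbert_space \<Rightarrow>\<^sub>L 'h) set \<Rightarrow> (('h \<Rightarrow>\<^sub>L 'h) set \<Rightarrow> ('h \<Rightarrow>\<^sub>L 'h) set) \<Rightarrow> bool"
  where "invariant_partial_ideal A \<pi> \<longleftrightarrow>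
    partial_ideal A \<pi> \<and>
    (\<forall>V \<in> comm_subalgebras A. \<forall>u \<in> A. unitary u \<longrightarrow> Ad u ` \<pi> V = \<pi> (Ad u ` V))"

definition partial_ideal_of ::
    "('h::complex_hilbert_space \<Rightarrow>\<^sub>L 'h) set \<Rightarrow> ('h \<Rightarrow>\<^sub>L 'h) set \<Rightarrow>
      (('h \<Rightarrow>\<^sub>L 'h) set \<Rightarrow> ('h \<Rightarrow>\<^sub>L 'h) set)"
  where "partial_ideal_of A I = (\<lambda>V \<in> comm_subalgebras A. I \<inter> V)"

end

theory Submission
  imports Defs
begin

text \<open>
  Let \<open>\<pi>\<close> be an invariant partial ideal.  By coherence, membership of an operator \<open>a\<close> in \<open>\<pi>(V)\<close> does
  not depend on the commutative algebra \<open>V\<close> containing \<open>a\<close>.  Zorn's lemma gives a maximal projection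
  \<open>e\<close> among those lying in \<open>\<pi>\<close>.  If \<open>e\<close> were not central, some nonzero subprojection \<open>q\<close> of \<open>e\<close> would be
  unitarily equivalent in \<open>\<A>\<close> to a projection below \<open>1 - e\<close>; by invariance the latter lies in \<open>\<pi>\<close>, and
  adding it to \<open>e\<close> contradicts maximality.  So \<open>e\<close> is central, every projection in \<open>\<pi>\<close> is below \<open>e\<close>, and
  \<open>\<pi>\<close> comes from the total ideal \<open>e\<A>\<close>, because an element lies in an ultraweakly closed ideal
  iff its range projection does.  The same remark shows that a total ideal is determined by its
  projections, hence by its partial ideal.

  Range projections and the exchanging unitary both come from the sign of a selfadjoint operator,
  obtained as the strong limit of the Newton iteration \<open>x \<mapsto> x (3 - x\<^sup>2) / 2\<close>; no spectral theorem is needed.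
\<close>

section \<open>Adjoints\<close>

text \<open>The representing vector is the minimiser of J(y) = |y|^2/2 - f(y): a minimising sequence
  is Cauchy by the parallelogram law, and the vanishing of the directional derivatives at its limit
  is the claimed identity.\<close>

lemma riesz_representation:
  fixes f :: "'a::{real_inner,complete_space} \<Rightarrow>\<^sub>L real"
  shows "\<exists>z. \<forall>y. f y = z \<bullet> y"
proof -
  define J where "J y = (y \<bullet> y) / 2 - f y" for y
  define m where "m = Inf (range J)"
  have "J y \<ge> - (norm f)\<^sup>2 / 2" for y
  proof -
    have "\<bar>f y\<bar> \<le> norm f * norm y"
      using norm_blinfun[of f y] by simp
    moreover have "0 \<le> (norm y - norm f)\<^sup>2" by simp
    ultimately show ?thesis
      unfolding J_def power2_norm_eq_inner[symmetric] by (simp add: power2_diff field_simps)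
  qed
  then have bdd: "bdd_below (range J)" by (intro bdd_belowI) auto
  have mJ: "m \<le> J y" for y
    unfolding m_def by (rule cInf_lower[OF _ bdd]) simp
  have "\<exists>y. J y < m + 1 / real (Suc n)" for n
    using cInf_lessD[of "range J" "m + 1 / real (Suc n)"] unfolding m_def by auto
  then obtain y where y: "\<And>n. J (y n) < m + 1 / real (Suc n)" by metis
  \<comment> \<open>Parallelogram law: the linear part of \<open>J\<close> cancels in this
    combination and only the quadratic part remains.\<close>
  have par: "(norm (u - v))\<^sup>2 = 4 * (J u + J v - 2 * J ((1/2) *\<^sub>R (u + v)))" for u v
    unfolding J_def power2_norm_eq_inner
    by (simp add: blinfun.bilinear_simps inner_add_left inner_add_right inner_diff_left
        inner_diff_right inner_commute field_simps)
  have close: "(norm (y n - y k))\<^sup>2 < 4 * (1 / real (Suc n) + 1 / real (Suc k))" for n k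
  proof -
    have "(norm (y n - y k))\<^sup>2 \<le> 4 * (J (y n) + J (y k) - 2 * m)"
      unfolding par using mJ[of "(1/2) *\<^sub>R (y n + y k)"] by simp
    also have "\<dots> < 4 * ((m + 1 / real (Suc n)) + (m + 1 / real (Suc k)) - 2 * m)"
      using add_strict_mono[OF y[of n] y[of k]] by simp
    finally show ?thesis by simp
  qed
  have "Cauchy y"
  proof (rule metric_CauchyI)
    fix e :: real assume e: "e > 0"
    obtain N where N: "1 / real (Suc N) < e\<^sup>2 / 8"
      using nat_approx_posE[of "e\<^sup>2 / 8"] e by auto
    have "dist (y n) (y k) < e" if "n \<ge> N" "k \<ge> N" for n k
    proof -
      have "1 / real (Suc n) \<le> 1 / real (Suc N)" "1 / real (Suc k) \<le> 1 / real (Suc N)"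
        using that by (auto simp: field_simps)
      then have "(norm (y n - y k))\<^sup>2 < e\<^sup>2"
        using close[of n k] N by argo
      then have "norm (y n - y k) < e"
        by (rule power_less_imp_less_base) (use e in simp)
      then show ?thesis by (simp add: dist_norm)
    qed
    then show "\<exists>M. \<forall>m\<ge>M. \<forall>n\<ge>M. dist (y m) (y n) < e" by blast
  qed
  then obtain z where z: "y \<longlonglongrightarrow> z"
    using Cauchy_convergent convergent_def by blast
  have "(\<lambda>n. J (y n)) \<longlonglongrightarrow> J z"
    unfolding J_def by (intro tendsto_intros z) simp
  moreover have "(\<lambda>n. m + 1 / real (Suc n)) \<longlonglongrightarrow> m + 0"
    by (intro tendsto_add tendsto_const LIMSEQ_Suc[OF lim_1_over_n])
  ultimately have Jz: "J z \<le> m"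
    using y by (intro LIMSEQ_le[of "\<lambda>n. J (y n)" "J z"]) (auto intro!: exI[of _ 0] less_imp_le)
  have "f x = z \<bullet> x" for x
  proof -
    define c b where "c = z \<bullet> x - f x" and "b = (x \<bullet> x) / 2"
    have b: "b \<ge> 0" by (simp add: b_def)
    have "J (z + t *\<^sub>R x) = J z + (t * c + t\<^sup>2 * b)" for t
      unfolding J_def c_def b_def
      by (simp add: blinfun.bilinear_simps inner_add_left inner_add_right inner_commute
          field_simps power2_eq_square)
    then have *: "t * c + t\<^sup>2 * b \<ge> 0" for t
      using Jz mJ[of "z + t *\<^sub>R x"] by (metis add_le_cancel_left add.right_neutral order_trans)
    \<comment> \<open>A polynomial t c + t^2 b that is nonnegative for all t has c = 0. It is tested
      at t = -c/(b + 1), since b itself may be zero.\<close>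
    define d where "d = b + 1"
    have d: "d > 0" using b by (simp add: d_def)
    have "0 \<le> (- c / d) * c + (- c / d)\<^sup>2 * b" by (rule *)
    also have "\<dots> = c\<^sup>2 * (b - d) / d\<^sup>2"
      using d by (simp add: field_simps power2_eq_square)
    also have "\<dots> = - (c\<^sup>2 / d\<^sup>2)" by (simp add: d_def)
    finally have "c\<^sup>2 \<le> 0"
      using d by (simp add: divide_le_0_iff)
    then have "c = 0" by simp
    then show ?thesis by (simp add: c_def)
  qed
  then show ?thesis by blast
qed

text \<open>The real inner product determines the complex form, so that adjoints can be handled over
  the reals once complex linearity is known.\<close>

lemma Im_cinner: "Im (cinner x y) = - (\<i> *\<^sub>C x \<bullet> y)"
  by (simp add: inner_eq_Re_cinner cinner_scaleC_left)

lemma cinner_scaleC_right: "cinner x (c *\<^sub>C y) = cnj c * cinner x y"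
  by (subst (1 2) cinner_commute) (simp add: cinner_scaleC_left)

text \<open>Real and imaginary parts are bounded separately by the real Cauchy-Schwarz inequality.
  The resulting factor 2 is harmless, because the bound only serves to dominate a series.\<close>

lemma norm_cinner_le: "cmod (cinner x y) \<le> 2 * (norm x * norm y)"
proof -
  have "\<bar>\<i> *\<^sub>C x \<bullet> y\<bar> \<le> norm x * norm y"
    using Cauchy_Schwarz_ineq2[of "\<i> *\<^sub>C x" y] by (simp add: norm_scaleC)
  then show ?thesis
    using cmod_le[of "cinner x y"] Cauchy_Schwarz_ineq2[of x y]
    by (simp add: Im_cinner flip: inner_eq_Re_cinner)
qed

lemma inner_ext: "(\<And>y. x \<bullet> y = z \<bullet> y) \<Longrightarrow> x = (z::'a::real_inner)"
proof -
  assume "\<And>y. x \<bullet> y = z \<bullet> y"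
  then have "(x - z) \<bullet> (x - z) = 0" by (simp add: inner_diff_left)
  then show ?thesis by simp
qed

lemma bounded_opsD: "a \<in> bounded_ops \<Longrightarrow> a (c *\<^sub>C x) = c *\<^sub>C a x"
  by (simp add: bounded_ops_def)

lemma cinner_eqI:
  fixes a b :: "'h::complex_hilbert_space \<Rightarrow>\<^sub>L 'h"
  assumes "\<And>x y. a x \<bullet> y = x \<bullet> b y" "a \<in> bounded_ops"
  shows "cinner (a x) y = cinner x (b y)"
proof (rule complex_eqI)
  show "Re (cinner (a x) y) = Re (cinner x (b y))"
    using assms(1) by (simp flip: inner_eq_Re_cinner)
  show "Im (cinner (a x) y) = Im (cinner x (b y))"
    using assms(1)[of "\<i> *\<^sub>C x" y] by (simp add: Im_cinner bounded_opsD[OF assms(2)])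
qed

text \<open>Evaluates the definite description \<open>adj\<close> from an identity between real
  inner products.\<close>

lemma adj_eqI:
  fixes a b :: "'h::complex_hilbert_space \<Rightarrow>\<^sub>L 'h"
  assumes "\<And>x y. a x \<bullet> y = x \<bullet> b y" "a \<in> bounded_ops"
  shows "adj a = b"
  unfolding adj_def
proof (rule the_equality)
  show "\<forall>x y. cinner (a x) y = cinner x (b y)"
    using cinner_eqI[OF assms] by blast
  fix b' assume "\<forall>x y. cinner (a x) y = cinner x (blinfun_apply b' y)"
  then have "cinner x (b' y) = cinner x (b y)" for x y
    using cinner_eqI[OF assms] by simp
  then have "b' y \<bullet> x = b y \<bullet> x" for x y
    by (subst (1 2) inner_commute) (simp add: inner_eq_Re_cinner)
  then show "b' = b" by (intro blinfun_eqI) (rule inner_ext)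
qed

text \<open>Riesz representation of x \<mapsto> a x \<bullet> y gives the value at y. Linearity
  follows from uniqueness, and the bound from |g x|^2 = a (g x) \<bullet> x.\<close>

lemma adj_exists:
  fixes a :: "'a::{real_inner,complete_space} \<Rightarrow>\<^sub>L 'a"
  shows "\<exists>b::'a \<Rightarrow>\<^sub>L 'a. \<forall>x y. a x \<bullet> y = x \<bullet> b y"
proof -
  have "\<exists>z. \<forall>x. a x \<bullet> y = z \<bullet> x" for y
    using riesz_representation[of "blinfun_inner_left y o\<^sub>L a"] by (auto simp: inner_commute)
  then obtain g where g: "\<And>x y. a x \<bullet> y = g y \<bullet> x" by metis
  have "bounded_linear g"
  proof (rule bounded_linear_intro[where K = "norm a"])
    show "g (x + y) = g x + g y" for x y
      by (rule inner_ext) (simp add: g[symmetric] inner_add_left inner_add_right)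
    show "g (r *\<^sub>R x) = r *\<^sub>R g x" for r x
      by (rule inner_ext) (simp add: g[symmetric])
    show "norm (g x) \<le> norm x * norm a" for x
    proof -
      have "norm (g x) * norm (g x) = a (g x) \<bullet> x"
        by (simp add: g power2_norm_eq_inner flip: power2_eq_square)
      also have "\<dots> \<le> norm (a (g x)) * norm x" by (rule norm_cauchy_schwarz)
      also have "\<dots> \<le> (norm a * norm (g x)) * norm x"
        by (intro mult_right_mono norm_blinfun) simp
      finally have "norm (g x) * norm (g x) \<le> norm (g x) * (norm x * norm a)"
        by (simp add: mult_ac)
      then show ?thesis
        by (cases "g x = 0") auto
    qed
  qed
  then have "\<forall>x y. a x \<bullet> y = x \<bullet> Blinfun g y"
    using g by (simp add: bounded_linear_Blinfun_apply) (metis inner_commute)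
  then show ?thesis by blast
qed

lemma inner_adj:
  fixes a :: "'h::complex_hilbert_space \<Rightarrow>\<^sub>L 'h"
  assumes "a \<in> bounded_ops"
  shows "a x \<bullet> y = x \<bullet> adj a y"
proof -
  obtain b where b: "\<And>x y. a x \<bullet> y = x \<bullet> blinfun_apply b y"
    using adj_exists[of a] by blast
  then have "adj a = b" using assms by (rule adj_eqI)
  with b show ?thesis by simp
qed

lemma inner_adj': "a \<in> bounded_ops \<Longrightarrow> adj a x \<bullet> y = x \<bullet> a y"
  using inner_adj[of a y x] by (simp add: inner_commute)

lemma cinner_adj: "a \<in> bounded_ops \<Longrightarrow> cinner (a x) y = cinner x (adj a y)"
  by (rule cinner_eqI) (rule inner_adj)

lemma cinner_eq_imp_eq: "(\<And>y. cinner x y = cinner z y) \<Longrightarrow> x = z"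
  by (rule inner_ext) (simp add: inner_eq_Re_cinner)

lemma adj_in_bounded_ops [simp]:
  assumes "a \<in> bounded_ops" shows "adj a \<in> bounded_ops"
proof -
  have "cinner (adj a (c *\<^sub>C x)) y = cinner (c *\<^sub>C adj a x) y" for c x y
  proof -
    have "cinner y (adj a (c *\<^sub>C x)) = cnj c * cinner y (adj a x)"
      by (simp add: cinner_scaleC_right flip: cinner_adj[OF assms])
    also have "\<dots> = cinner y (c *\<^sub>C adj a x)"
      by (simp add: cinner_scaleC_right)
    finally show ?thesis
      by (subst (1 2) cinner_commute) simp
  qed
  then have "adj a (c *\<^sub>C x) = c *\<^sub>C adj a x" for c x
    by (rule cinner_eq_imp_eq)
  then show ?thesis by (simp add: bounded_ops_def)
qed

section \<open>Closure properties of B(H) and rules for adjoints\<close>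

lemma bounded_ops_add [simp]: "a \<in> bounded_ops \<Longrightarrow> b \<in> bounded_ops \<Longrightarrow> a + b \<in> bounded_ops"
  by (simp add: bounded_ops_def blinfun.add_left scaleC_add_right)

lemma bounded_ops_compose [simp]:
  "a \<in> bounded_ops \<Longrightarrow> b \<in> bounded_ops \<Longrightarrow> a o\<^sub>L b \<in> bounded_ops"
  by (simp add: bounded_ops_def)

lemma bounded_ops_scale [simp]: "a \<in> bounded_ops \<Longrightarrow> scale_op c a \<in> bounded_ops"
  unfolding bounded_ops_def mem_Collect_eq scale_op.rep_eq
  by (metis mult.commute scaleC_scaleC)

lemma bounded_ops_id [simp]: "id_blinfun \<in> bounded_ops"
  by (simp add: bounded_ops_def)

lemma scaleR_eq_scale_op: "r *\<^sub>R a = scale_op (complex_of_real r) a"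
  by (rule blinfun_eqI) (simp add: scale_op.rep_eq scaleC_of_real blinfun.scaleR_left)

lemma bounded_ops_scaleR [simp]: "a \<in> bounded_ops \<Longrightarrow> r *\<^sub>R a \<in> bounded_ops"
  by (simp add: scaleR_eq_scale_op)

lemma bounded_ops_diff [simp]: "a \<in> bounded_ops \<Longrightarrow> b \<in> bounded_ops \<Longrightarrow> a - b \<in> bounded_ops"
  using bounded_ops_add[of a "(-1) *\<^sub>R b"] bounded_ops_scaleR[of b "-1"] by simp

lemma adj_adj [simp]: "a \<in> bounded_ops \<Longrightarrow> adj (adj a) = a"
  by (rule adj_eqI) (simp_all add: inner_adj')

lemma adj_compose: "a \<in> bounded_ops \<Longrightarrow> b \<in> bounded_ops \<Longrightarrow> adj (a o\<^sub>L b) = adj b o\<^sub>L adj a"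
  by (rule adj_eqI) (simp_all add: inner_adj)

text \<open>Stated with the real inner product, so that the iteration for the sign can run over a
  real Hilbert space. For complex-linear operators it amounts to \<open>adj a = a\<close>.\<close>

definition selfadjoint :: "('a::real_inner \<Rightarrow>\<^sub>L 'a) \<Rightarrow> bool"
  where "selfadjoint a \<longleftrightarrow> (\<forall>x y. a x \<bullet> y = x \<bullet> a y)"

lemma selfadjointD: "selfadjoint a \<Longrightarrow> a x \<bullet> y = x \<bullet> a y"
  by (simp add: selfadjoint_def)

lemma adj_selfadjoint: "selfadjoint a \<Longrightarrow> a \<in> bounded_ops \<Longrightarrow> adj a = a"
  by (rule adj_eqI) (simp_all add: selfadjointD)

definition projection :: "('h::complex_hilbert_space \<Rightarrow>\<^sub>L 'h) \<Rightarrow> bool"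
  where "projection p \<longleftrightarrow> p \<in> bounded_ops \<and> selfadjoint p \<and> p o\<^sub>L p = p"

lemma projection_adj: "projection p \<Longrightarrow> adj p = p"
  by (simp add: projection_def adj_selfadjoint)

lemma projection_apply_twice: "projection p \<Longrightarrow> p (p x) = p x"
  unfolding projection_def by (metis blinfun_apply_blinfun_compose)

lemma projection_norm_le: "projection p \<Longrightarrow> norm p \<le> 1"
proof (rule norm_blinfun_bound)
  fix x assume p: "projection p"
  have "norm (p x) * norm (p x) = p x \<bullet> p x"
    by (simp add: power2_norm_eq_inner flip: power2_eq_square)
  also have "\<dots> = p x \<bullet> x"
    using p projection_apply_twice[OF p] unfolding projection_def by (metis selfadjointD)
  also have "\<dots> \<le> norm (p x) * norm x" by (rule norm_cauchy_schwarz)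
  finally show "norm (p x) \<le> 1 * norm x"
    by (cases "p x = 0") auto
qed simp


section \<open>Strong limits and closed sets of operators\<close>

text \<open>A pointwise limit is linear and inherits the uniform bound. The filter is arbitrary:
  sequences are used for signs of operators, a filter of tails for chains of projections.\<close>

lemma strong_limit_exists:
  fixes a :: "'i \<Rightarrow> 'a::real_normed_vector \<Rightarrow>\<^sub>L 'b::real_normed_vector"
  assumes F: "F \<noteq> bot" and K: "\<And>i. norm (a i) \<le> K"
    and lim: "\<And>y. \<exists>l. ((\<lambda>i. a i y) \<longlongrightarrow> l) F"
  shows "\<exists>w. \<forall>y. ((\<lambda>i. a i y) \<longlongrightarrow> blinfun_apply w y) F"
proof -
  obtain g where g: "\<And>y. ((\<lambda>i. a i y) \<longlongrightarrow> g y) F" using lim by metis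
  have "bounded_linear g"
  proof (rule bounded_linear_intro[where K = K])
    show "g (x + y) = g x + g y" for x y
      using tendsto_add[OF g[of x] g[of y]] g[of "x + y"] F
      by (intro tendsto_unique[OF F]) (auto simp: blinfun.add_right)
    show "g (r *\<^sub>R x) = r *\<^sub>R g x" for r x
      using tendsto_scaleR[OF tendsto_const[of r] g[of x]] g[of "r *\<^sub>R x"]
      by (intro tendsto_unique[OF F]) (auto simp: blinfun.scaleR_right)
    show "norm (g x) \<le> norm x * K" for x
    proof (rule tendsto_upperbound[OF tendsto_norm[OF g] always_eventually F], rule allI)
      fix i
      have "norm (a i x) \<le> norm (a i) * norm x" by (rule norm_blinfun)
      also have "\<dots> \<le> K * norm x" by (intro mult_right_mono K) simp
      finally show "norm (a i x) \<le> norm x * K" by (simp add: mult.commute)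
    qed
  qed
  then show ?thesis
    using g by (intro exI[of _ "Blinfun g"]) (simp add: bounded_linear_Blinfun_apply)
qed

text \<open>Split a_i b_i = a_i (b_i - z) + a_i z; the uniform bound on the operators makes the
  first term tend to zero.\<close>

lemma strong_limit_compose:
  assumes K: "\<And>i. norm (a i) \<le> K"
    and a: "\<And>y. ((\<lambda>i. blinfun_apply (a i) y) \<longlongrightarrow> blinfun_apply v y) F"
    and b: "((\<lambda>i. b i) \<longlongrightarrow> z) F"
  shows "((\<lambda>i. blinfun_apply (a i) (b i)) \<longlongrightarrow> v z) F"
proof -
  have "((\<lambda>i. a i (b i - z)) \<longlongrightarrow> 0) F"
  proof (rule Lim_null_comparison[OF always_eventually], rule allI)
    fix i
    have "norm (a i (b i - z)) \<le> norm (a i) * norm (b i - z)" by (rule norm_blinfun)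
    also have "\<dots> \<le> K * norm (b i - z)" by (intro mult_right_mono K) simp
    finally show "norm (a i (b i - z)) \<le> K * norm (b i - z)" .
  next
    show "((\<lambda>i. K * norm (b i - z)) \<longlongrightarrow> 0) F"
      using tendsto_mult[OF tendsto_const[of K] tendsto_norm[OF tendsto_diff[OF b tendsto_const[of z]]]]
      by simp
  qed
  from tendsto_add[OF this a[of z]] show ?thesis
    by (simp add: blinfun.diff_right)
qed

lemma strong_limit_selfadjoint:
  assumes F: "F \<noteq> bot" and "\<And>i. selfadjoint (a i)"
    and lim: "\<And>y. ((\<lambda>i. blinfun_apply (a i) y) \<longlongrightarrow> blinfun_apply w y) F"
  shows "selfadjoint w"
  unfolding selfadjoint_def
proof (intro allI)
  fix x y
  have "((\<lambda>i. a i x \<bullet> y) \<longlongrightarrow> w x \<bullet> y) F" "((\<lambda>i. a i x \<bullet> y) \<longlongrightarrow> x \<bullet> w y) F"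
    using tendsto_inner[OF lim[of x] tendsto_const[of y]]
      tendsto_inner[OF tendsto_const[of x] lim[of y]] assms(2) by (simp_all add: selfadjointD)
  then show "w x \<bullet> y = x \<bullet> w y" by (rule tendsto_unique[OF F])
qed

lemma strong_limit_bounded_ops:
  assumes F: "F \<noteq> bot" and "\<And>i. a i \<in> bounded_ops"
    and lim: "\<And>y. ((\<lambda>i. blinfun_apply (a i) y) \<longlongrightarrow> blinfun_apply w y) F"
  shows "w \<in> bounded_ops"
  unfolding bounded_ops_def
proof (intro CollectI allI)
  fix c x
  have "((\<lambda>i. c *\<^sub>C a i x) \<longlongrightarrow> c *\<^sub>C w x) F"
    by (rule bounded_linear.tendsto[OF bounded_linear_scaleC lim])
  then show "w (c *\<^sub>C x) = c *\<^sub>C w x"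
    using lim[of "c *\<^sub>C x"] assms(2) by (intro tendsto_unique[OF F]) (simp_all add: bounded_opsD)
qed

section \<open>Topologies generated by functionals\<close>

lemma topspace_op_topology [simp]: "topspace (op_topology \<Phi>) = bounded_ops"
  by (auto simp: op_topology_def)

text \<open>In an initial topology convergence is tested on the generating functionals. The proof is
  an induction over the way an open set is generated.\<close>

lemma limitin_op_topology:
  assumes l: "l \<in> bounded_ops" and a: "\<And>i. a i \<in> bounded_ops"
    and lim: "\<And>\<phi>. \<phi> \<in> \<Phi> \<Longrightarrow> ((\<lambda>i. \<phi> (a i)) \<longlongrightarrow> \<phi> l) F"
  shows "limitin (op_topology \<Phi>) a l F"
  unfolding limitin_def
proof (intro conjI allI impI)
  show "l \<in> topspace (op_topology \<Phi>)" using l by simp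
  fix U assume U: "openin (op_topology \<Phi>) U \<and> l \<in> U"
  then have "generate_topology_on
      (insert bounded_ops {{a \<in> bounded_ops. \<phi> a \<in> U} | \<phi> U. \<phi> \<in> \<Phi> \<and> open U}) U"
    unfolding op_topology_def openin_topology_generated_by_iff by simp
  then have "l \<in> U \<longrightarrow> eventually (\<lambda>i. a i \<in> U) F"
  proof induction
    case (UN K)
    show ?case
    proof
      assume "l \<in> \<Union> K"
      then obtain X where "X \<in> K" "l \<in> X" by blast
      with UN have "eventually (\<lambda>i. a i \<in> X) F" by blast
      then show "eventually (\<lambda>i. a i \<in> \<Union> K) F"
        by (rule eventually_mono) (use \<open>X \<in> K\<close> in blast)
    qed
  next
    case (Basis s)
    then show ?case
      using a by (auto dest!: lim topological_tendstoD)
  qed (auto intro: eventually_conj)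
  with U show "eventually (\<lambda>i. a i \<in> U) F" by simp
qed

lemma continuous_map_op_topology_functional:
  assumes "\<phi> \<in> \<Phi>"
  shows "continuous_map (op_topology \<Phi>) euclidean \<phi>"
  unfolding continuous_map_def
proof (intro conjI allI impI)
  fix U :: "complex set" assume "openin euclidean U"
  then show "openin (op_topology \<Phi>) {x \<in> topspace (op_topology \<Phi>). \<phi> x \<in> U}"
    unfolding topspace_op_topology unfolding op_topology_def
    using assms by (intro topology_generated_by_Basis) auto
qed simp

lemma closedin_op_topology_eq:
  assumes "\<phi> \<in> \<Phi>" "\<psi> \<in> \<Phi>"
  shows "closedin (op_topology \<Phi>) {a \<in> bounded_ops. \<phi> a = \<psi> a}"
proof -
  have "closedin (op_topology \<Phi>) {a \<in> topspace (op_topology \<Phi>). \<phi> a - \<psi> a \<in> {0}}"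
    by (rule closedin_continuous_map_preimage[where Y = euclidean, OF continuous_map_diff])
      (auto intro: continuous_map_op_topology_functional assms)
  then show ?thesis by simp
qed

text \<open>Universal property of the initial topology: it suffices that each functional of the
  target, composed with \<open>f\<close>, is a functional of the source.\<close>

lemma continuous_map_op_topology:
  assumes "\<And>a. a \<in> bounded_ops \<Longrightarrow> f a \<in> bounded_ops"
    and "\<And>\<phi>. \<phi> \<in> \<Psi> \<Longrightarrow> \<exists>\<psi>\<in>\<Phi>. \<forall>a\<in>bounded_ops. \<phi> (f a) = \<psi> a"
  shows "continuous_map (op_topology \<Phi>) (op_topology \<Psi>) f"
  unfolding op_topology_def[of \<Psi>] continuous_on_generated_topo_iff
proof (intro conjI allI impI)
  fix U assume "U \<in> insert bounded_ops {{a \<in> bounded_ops. \<phi> a \<in> U} | \<phi> U. \<phi> \<in> \<Psi> \<and> open U}"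
  then consider "U = bounded_ops" | \<phi> W where "U = {a \<in> bounded_ops. \<phi> a \<in> W}" "\<phi> \<in> \<Psi>" "open W"
    by blast
  then show "openin (op_topology \<Phi>) (f -` U \<inter> topspace (op_topology \<Phi>))"
  proof cases
    case 1
    then have "f -` U \<inter> topspace (op_topology \<Phi>) = topspace (op_topology \<Phi>)"
      using assms(1) by auto
    then show ?thesis by (simp only: openin_topspace)
  next
    case 2
    then obtain \<psi> where \<psi>: "\<psi> \<in> \<Phi>" "\<And>a. a \<in> bounded_ops \<Longrightarrow> \<phi> (f a) = \<psi> a"
      using assms(2) by blast
    then have "f -` U \<inter> topspace (op_topology \<Phi>) = {a \<in> topspace (op_topology \<Phi>). \<psi> a \<in> W}"
      using 2 assms(1) by auto
    also have "openin (op_topology \<Phi>) \<dots>"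
      using continuous_map_op_topology_functional[OF \<psi>(1)] 2
      by (simp add: continuous_map_def)
    finally show ?thesis .
  qed
qed (use assms(1) in auto)

section \<open>Ultraweak topology, strong limits and the weak operator topology\<close>

lemma summable_mult_of_square_summable:
  fixes x y :: "nat \<Rightarrow> 'h::complex_hilbert_space"
  assumes "summable (\<lambda>n. (norm (x n))\<^sup>2)" "summable (\<lambda>n. (norm (y n))\<^sup>2)"
  shows "summable (\<lambda>n. norm (x n) * norm (y n))"
proof (rule summable_comparison_test)
  show "summable (\<lambda>n. ((norm (x n))\<^sup>2 + (norm (y n))\<^sup>2) / 2)"
    by (intro summable_divide summable_add assms)
  have "norm (x n) * norm (y n) \<le> ((norm (x n))\<^sup>2 + (norm (y n))\<^sup>2) / 2" for n
    using sum_squares_bound[of "norm (x n)" "norm (y n)"] by simp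
  then show "\<exists>N. \<forall>n\<ge>N. norm (norm (x n) * norm (y n)) \<le> ((norm (x n))\<^sup>2 + (norm (y n))\<^sup>2) / 2"
    by simp
qed


text \<open>A bounded strongly convergent family converges ultraweakly: every term of a defining
  series converges, and the uniform bound provides a summable majorant, so limit and sum may be
  exchanged (Tannery).\<close>

lemma ultraweakly_closed_strong_limit:
  fixes a :: "'i \<Rightarrow> 'h::complex_hilbert_space \<Rightarrow>\<^sub>L 'h"
  assumes J: "closedin ultraweak_topology J" and F: "F \<noteq> bot"
    and K: "\<And>i. norm (a i) \<le> K" and aJ: "\<And>i. a i \<in> J"
    and lim: "\<And>y. ((\<lambda>i. blinfun_apply (a i) y) \<longlongrightarrow> blinfun_apply w y) F"
  shows "w \<in> J"
proof -
  have ab: "a i \<in> bounded_ops" for i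
    using closedin_subset[OF J] aJ[of i] by (auto simp: ultraweak_topology_def)
  then have "w \<in> bounded_ops"
    using strong_limit_bounded_ops[OF F _ lim] by blast
  then have "limitin ultraweak_topology a w F"
    unfolding ultraweak_topology_def
  proof (rule limitin_op_topology[OF _ ab])
    fix \<phi> :: "('h \<Rightarrow>\<^sub>L 'h) \<Rightarrow> complex"
    assume "\<phi> \<in> {\<lambda>a. \<Sum>n. cinner (blinfun_apply a (x n)) (y n) | x y :: nat \<Rightarrow> 'h.
      summable (\<lambda>n. (norm (x n))\<^sup>2) \<and> summable (\<lambda>n. (norm (y n))\<^sup>2)}"
    then obtain x y :: "nat \<Rightarrow> 'h" where \<phi>: "\<phi> = (\<lambda>a. \<Sum>n. cinner (blinfun_apply a (x n)) (y n))"
      and xy: "summable (\<lambda>n. (norm (x n))\<^sup>2)" "summable (\<lambda>n. (norm (y n))\<^sup>2)"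
      by blast
    have "((\<lambda>i. \<Sum>n. cinner (a i (x n)) (y n)) \<longlongrightarrow> (\<Sum>n. cinner (w (x n)) (y n))) F"
    proof (rule tannerys_theorem[THEN conjunct2, THEN conjunct2, OF _ always_eventually _ F])
      show "((\<lambda>i. cinner (a i (x n)) (y n)) \<longlongrightarrow> cinner (w (x n)) (y n)) F" for n
      proof (rule iffD2[OF tendsto_complex_iff], intro conjI)
        show "((\<lambda>i. Re (cinner (a i (x n)) (y n))) \<longlongrightarrow> Re (cinner (w (x n)) (y n))) F"
          unfolding inner_eq_Re_cinner[symmetric] by (intro tendsto_intros lim)
        show "((\<lambda>i. Im (cinner (a i (x n)) (y n))) \<longlongrightarrow> Im (cinner (w (x n)) (y n))) F"
          unfolding Im_cinner
          by (intro tendsto_intros lim bounded_linear.tendsto[OF bounded_linear_scaleC])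
      qed
      have "norm (cinner (a i (x n)) (y n)) \<le> (2 * K) * (norm (x n) * norm (y n))" for n i
      proof -
        have "norm (a i (x n)) \<le> K * norm (x n)"
          by (rule order_trans[OF norm_blinfun]) (intro mult_right_mono K norm_ge_zero)
        then have "norm (a i (x n)) * norm (y n) \<le> K * norm (x n) * norm (y n)"
          by (rule mult_right_mono) simp
        then show ?thesis
          using norm_cinner_le[of "a i (x n)" "y n"] by (simp add: mult_ac)
      qed
      then show "\<forall>p. case p of (n, i) \<Rightarrow> norm (cinner (a i (x n)) (y n)) \<le> (2 * K) * (norm (x n) * norm (y n))"
        by auto
      show "summable (\<lambda>n. (2 * K) * (norm (x n) * norm (y n)))"
        by (intro summable_mult summable_mult_of_square_summable xy)
    qed
    then show "((\<lambda>i. \<phi> (a i)) \<longlongrightarrow> \<phi> w) F" by (simp add: \<phi>)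
  qed
  then show ?thesis
    by (rule limitin_closedin[OF _ J]) (use aJ F in auto)
qed

text \<open>Take both sequences to vanish past index 0. Hence every weak operator functional is also
  an ultraweak one.\<close>

lemma ultraweak_vector_functional:
  fixes x y :: "'h::complex_hilbert_space"
  shows "(\<lambda>a. cinner (blinfun_apply a x) y) \<in>
    {\<lambda>a. \<Sum>n. cinner (blinfun_apply a (x n)) (y n) | x y :: nat \<Rightarrow> 'h.
      summable (\<lambda>n. (norm (x n))\<^sup>2) \<and> summable (\<lambda>n. (norm (y n))\<^sup>2)}"
proof -
  have c0: "cinner 0 z = 0" for z :: 'h
    by (metis cinner_add_left add_cancel_right_right)
  define d where "d z n = (if n = 0 then z else 0)" for z :: 'h and n :: nat
  have s: "summable (\<lambda>n. (norm (d z n))\<^sup>2)" for z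
    by (rule summable_finite[of "{0}"]) (auto simp: d_def)
  have "(\<Sum>n. cinner (blinfun_apply a (d x n)) (d y n)) = cinner (blinfun_apply a x) y" for a :: "'h \<Rightarrow>\<^sub>L 'h"
    by (subst suminf_finite[of "{0}"]) (auto simp: d_def c0)
  then show ?thesis
    by (intro CollectI exI[of _ "d x"] exI[of _ "d y"]) (simp add: s)
qed

lemma closedin_weak_imp_ultraweak:
  fixes C :: "('a::complex_hilbert_space \<Rightarrow>\<^sub>L 'a) set"
  assumes "closedin weak_op_topology C"
  shows "closedin ultraweak_topology C"
proof -
  have "continuous_map ultraweak_topology weak_op_topology (\<lambda>a::'a \<Rightarrow>\<^sub>L 'a. a)"
    unfolding ultraweak_topology_def weak_op_topology_def
  proof (rule continuous_map_op_topology)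
    fix \<phi> :: "('a \<Rightarrow>\<^sub>L 'a) \<Rightarrow> complex"
    assume "\<phi> \<in> {\<lambda>a. cinner (blinfun_apply a x) y | x y. True}"
    then obtain x y where "\<phi> = (\<lambda>a. cinner (blinfun_apply a x) y)" by blast
    then show "\<exists>\<psi>\<in>{\<lambda>a. \<Sum>n. cinner (blinfun_apply a (x n)) (y n) | x y :: nat \<Rightarrow> 'a.
        summable (\<lambda>n. (norm (x n))\<^sup>2) \<and> summable (\<lambda>n. (norm (y n))\<^sup>2)}. \<forall>a\<in>bounded_ops. \<phi> a = \<psi> a"
      using ultraweak_vector_functional[of x y] by (intro bexI[of _ \<phi>]) simp_all
  qed
  from closedin_continuous_map_preimage[OF this assms]
  have "closedin ultraweak_topology {a \<in> bounded_ops. a \<in> C}"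
    by (simp add: ultraweak_topology_def)
  moreover have "C \<subseteq> bounded_ops"
    using closedin_subset[OF assms] by (simp add: weak_op_topology_def)
  then have "{a \<in> bounded_ops. a \<in> C} = C" by blast
  ultimately show ?thesis by simp
qed

text \<open>Moving \<open>s\<close> to the other side as \<open>adj s\<close> turns both sides of a
  s = s a into weak functionals of \<open>a\<close>; the commutant is the intersection of the
  resulting equalisers.\<close>

lemma closedin_weak_commutant:
  fixes S :: "('h::complex_hilbert_space \<Rightarrow>\<^sub>L 'h) set"
  assumes S: "S \<subseteq> bounded_ops"
  shows "closedin weak_op_topology {a \<in> bounded_ops. \<forall>s\<in>S. a o\<^sub>L s = s o\<^sub>L a}"
\<comment> \<open>An empty intersection would be the whole type, which also contains maps that are
  not complex-linear.\<close>
proof (cases "S = {}")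
  case True
  then show ?thesis
    using closedin_topspace[of weak_op_topology] by (simp add: weak_op_topology_def)
next
  case False
  define K where "K s x y =
    {a \<in> bounded_ops. cinner (blinfun_apply a (blinfun_apply s x)) y = cinner (blinfun_apply a x) (blinfun_apply (adj s) y)}"
    for s :: "'h \<Rightarrow>\<^sub>L 'h" and x y
  have "closedin weak_op_topology (K s x y)" for s x y
    unfolding weak_op_topology_def K_def by (rule closedin_op_topology_eq) blast+
  then have "closedin weak_op_topology
      (\<Inter>(s, x, y) \<in> S \<times> UNIV \<times> UNIV. K s x y)"
    using False by (intro closedin_Inter) auto
  also have "(\<Inter>(s, x, y) \<in> S \<times> UNIV \<times> UNIV. K s x y)
      = {a \<in> bounded_ops. \<forall>s\<in>S. a o\<^sub>L s = s o\<^sub>L a}" (is "?L = ?R")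
  proof (intro equalityI subsetI)
    fix a assume a: "a \<in> ?L"
    then have "a \<in> bounded_ops" using False by (auto simp: K_def)
    moreover have "a o\<^sub>L s = s o\<^sub>L a" if s: "s \<in> S" for s
    proof (rule blinfun_eqI, unfold blinfun_apply_blinfun_compose, rule cinner_eq_imp_eq)
      fix x y
      have "cinner (blinfun_apply a (s x)) y = cinner (blinfun_apply a x) (adj s y)"
        using a s by (auto simp: K_def)
      then show "cinner (a (s x)) y = cinner (s (a x)) y"
        using cinner_adj[of s "a x" y] s S by auto
    qed
    ultimately show "a \<in> ?R" by blast
  next
    fix a assume a: "a \<in> ?R"
    have "cinner (a (s x)) y = cinner (a x) (adj s y)" if "s \<in> S" for s x y
    proof -
      have "a (s x) = s (a x)"
        using a that by (metis (mono_tags, lifting) blinfun_apply_blinfun_compose mem_Collect_eq)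
      then show ?thesis using cinner_adj[of s "a x" y] that S by auto
    qed
    with a show "a \<in> ?L" by (auto simp: K_def)
  qed
  finally show ?thesis .
qed


lemma blinfun_compose_assoc: "(a o\<^sub>L b) o\<^sub>L c = a o\<^sub>L (b o\<^sub>L c)"
  by (rule blinfun_eqI) simp


section \<open>The sign of a selfadjoint operator\<close>

text \<open>Polynomials in \<open>k\<close>, given inductively to allow proofs by induction. For
  \<open>S = {0..}\<close> the coefficients are nonnegative, which preserves positivity; for
  \<open>S = UNIV\<close> all real polynomials occur.\<close>

inductive_set op_polys :: "real set \<Rightarrow> ('a::real_normed_vector \<Rightarrow>\<^sub>L 'a) \<Rightarrow> ('a \<Rightarrow>\<^sub>L 'a) set"
  for S :: "real set" and k :: "'a \<Rightarrow>\<^sub>L 'a"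
  where
    id: "id_blinfun \<in> op_polys S k"
  | add: "a \<in> op_polys S k \<Longrightarrow> b \<in> op_polys S k \<Longrightarrow> a + b \<in> op_polys S k"
  | scaleR: "r \<in> S \<Longrightarrow> a \<in> op_polys S k \<Longrightarrow> r *\<^sub>R a \<in> op_polys S k"
  | mult: "a \<in> op_polys S k \<Longrightarrow> k o\<^sub>L a \<in> op_polys S k"

lemma op_polys_commute:
  fixes k :: "'a::real_normed_vector \<Rightarrow>\<^sub>L 'a"
  assumes c: "c \<in> op_polys S k" and b: "\<And>y. blinfun_apply b (k y) = k (blinfun_apply b y)"
  shows "b (c y) = c (b y)"
  using c by (induction arbitrary: y) (simp_all add: b blinfun.bilinear_simps)

lemma op_polys_compose:
  assumes "a \<in> op_polys S k" "b \<in> op_polys S k"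
  shows "a o\<^sub>L b \<in> op_polys S k"
  using assms(1)
proof induction
  case id
  have "id_blinfun o\<^sub>L b = b" by (rule blinfun_eqI) simp
  then show ?case using assms(2) by simp
next
  case (add a1 a2)
  have "(a1 + a2) o\<^sub>L b = (a1 o\<^sub>L b) + (a2 o\<^sub>L b)"
    by (rule blinfun_eqI) (simp add: blinfun.bilinear_simps)
  then show ?case using add by (simp add: op_polys.add)
next
  case (scaleR r a)
  have "(r *\<^sub>R a) o\<^sub>L b = r *\<^sub>R (a o\<^sub>L b)"
    by (rule blinfun_eqI) (simp add: blinfun.bilinear_simps)
  then show ?case using scaleR by (simp add: op_polys.scaleR)
next
  case (mult a)
  then show ?case by (simp add: blinfun_compose_assoc op_polys.mult)
qed

lemma op_polys_selfadjoint:
  assumes k: "selfadjoint k" and c: "c \<in> op_polys S k"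
  shows "selfadjoint c"
  using c
proof induction
  case (mult a)
  have "k (a y) = a (k y)" for y by (rule op_polys_commute[OF mult(1)]) simp
  with mult k show ?case by (simp add: selfadjoint_def)
qed (simp_all add: selfadjoint_def blinfun.bilinear_simps inner_add_left inner_add_right)

text \<open>
  The two conjuncts cover even and odd powers of \<open>k\<close>; only sums of powers occur, so
  that no square root of \<open>k\<close> is needed.
\<close>

lemma op_polys_nonneg:
  fixes k :: "'a::real_inner \<Rightarrow>\<^sub>L 'a"
  assumes k: "selfadjoint k" "\<And>y. k y \<bullet> y \<ge> 0" and c: "c \<in> op_polys {0..} k"
  shows "c y \<bullet> y \<ge> 0 \<and> k (c y) \<bullet> y \<ge> 0"
  using c
proof (induction arbitrary: y)
  case (mult a)
  have "k (k (a y)) \<bullet> y = a (k y) \<bullet> k y"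
    using op_polys_commute[OF mult(1), of k y] k(1) by (simp add: selfadjointD)
  with mult show ?case by simp
qed (simp_all add: k blinfun.bilinear_simps inner_add_left)

text \<open>Substituting k = 1 + r g turns a polynomial in \<open>k\<close> into one in
  \<open>g\<close>; since \<open>r\<close> may be negative, the sign of the coefficients is
  lost.\<close>

lemma op_polys_change:
  fixes k g :: "'a::real_normed_vector \<Rightarrow>\<^sub>L 'a"
  assumes "\<And>y. k y = y + r *\<^sub>R g y" and "c \<in> op_polys S k"
  shows "c \<in> op_polys UNIV g"
  using assms(2)
proof induction
  case (mult a)
  have "k o\<^sub>L a = a + r *\<^sub>R (g o\<^sub>L a)"
    by (rule blinfun_eqI) (simp add: assms(1) blinfun.bilinear_simps)
  with mult show ?case by (simp add: op_polys.intros)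
qed (auto intro: op_polys.intros)

section \<open>The Newton iteration for a selfadjoint contraction\<close>

locale newton_iteration =
  fixes h :: "'a::{real_inner,complete_space} \<Rightarrow>\<^sub>L 'a"
  assumes sa: "selfadjoint h" and contraction: "norm h \<le> 1"
begin

definition k where "k = id_blinfun - (h o\<^sub>L h)"

text \<open>For the iterate x this is d = 1 - x^2. The next iterate is x (1 + d/2), so the next
  defect is 1 - (1 - d)(1 + d/2)^2 = d^2 (3 + d)/4. The coefficients are nonnegative, so every
  defect is a positive polynomial in \<open>k\<close>.\<close>

primrec defect :: "nat \<Rightarrow> ('a \<Rightarrow>\<^sub>L 'a)"
  where "defect 0 = k"
  | "defect (Suc n) = (1/4) *\<^sub>R (defect n o\<^sub>L defect n o\<^sub>L (3 *\<^sub>R id_blinfun + defect n))"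

text \<open>Since (3 - x^2)/2 = 1 + d/2, the iterates are \<open>h\<close> times these products,
  which are again polynomials in \<open>k\<close> with nonnegative coefficients.\<close>

primrec factor :: "nat \<Rightarrow> ('a \<Rightarrow>\<^sub>L 'a)"
  where "factor 0 = id_blinfun"
  | "factor (Suc n) = factor n o\<^sub>L (id_blinfun + (1/2) *\<^sub>R defect n)"

definition iterate :: "nat \<Rightarrow> ('a \<Rightarrow>\<^sub>L 'a)"
  where "iterate n = h o\<^sub>L factor n"

lemma k_apply: "k y = y - h (h y)"
  by (simp add: k_def blinfun.bilinear_simps)

lemma k_selfadjoint: "selfadjoint k"
  using sa by (simp add: selfadjoint_def k_apply inner_diff_left inner_diff_right)

lemma h_norm_le: "norm (h y) \<le> norm y"
  using norm_blinfun[of h y] mult_right_mono[OF contraction norm_ge_zero[of y]] by simp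

lemma k_nonneg: "k y \<bullet> y \<ge> 0"
proof -
  have "k y \<bullet> y = (norm y)\<^sup>2 - (norm (h y))\<^sup>2"
    using sa by (simp add: k_apply inner_diff_left selfadjointD power2_norm_eq_inner)
  then show ?thesis
    using h_norm_le[of y] by (simp add: power_mono)
qed

lemma defect_in: "defect n \<in> op_polys {0..} k"
proof (induction n)
  case 0
  have "k o\<^sub>L id_blinfun = k" by (rule blinfun_eqI) simp
  then show ?case using op_polys.mult[where S = "{0..}" and k = k, OF op_polys.id] by simp
next
  case (Suc n)
  then show ?case by (auto intro!: op_polys_compose op_polys.intros)
qed

lemma factor_in: "factor n \<in> op_polys {0..} k"
  by (induction n) (auto intro!: op_polys_compose op_polys.intros defect_in)

lemma h_commute: "c \<in> op_polys {0..} k \<Longrightarrow> h (c y) = c (h y)"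
  by (rule op_polys_commute[where S = "{0..}" and k = k]) (auto simp: k_apply blinfun.bilinear_simps)

lemma polys_commute: "c \<in> op_polys {0..} k \<Longrightarrow> d \<in> op_polys {0..} k \<Longrightarrow> c (d y) = d (c y)"
  by (rule op_polys_commute[where S = "{0..}" and k = k and b = c and c = d], assumption)
    (rule op_polys_commute[where S = "{0..}" and k = k and b = k and c = c, symmetric], auto)

lemma poly_nonneg: "c \<in> op_polys {0..} k \<Longrightarrow> c y \<bullet> y \<ge> 0"
  using op_polys_nonneg[OF k_selfadjoint k_nonneg] by blast

lemma poly_selfadjoint: "c \<in> op_polys {0..} k \<Longrightarrow> selfadjoint c"
  by (rule op_polys_selfadjoint[OF k_selfadjoint])

lemma iterate_apply: "iterate n y = h (factor n y)"
  by (simp add: iterate_def)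

lemma iterate_selfadjoint: "selfadjoint (iterate n)"
  unfolding selfadjoint_def
proof (intro allI)
  fix x y
  have "h (factor n x) \<bullet> y = factor n x \<bullet> h y" by (rule selfadjointD[OF sa])
  also have "\<dots> = x \<bullet> factor n (h y)" by (rule selfadjointD[OF poly_selfadjoint[OF factor_in]])
  also have "\<dots> = x \<bullet> h (factor n y)" by (simp only: h_commute[OF factor_in])
  finally show "iterate n x \<bullet> y = x \<bullet> iterate n y" by (simp only: iterate_apply)
qed

lemma iterate_Suc: "iterate (Suc n) y = iterate n (y + (1/2) *\<^sub>R defect n y)"
  by (simp add: iterate_apply blinfun.bilinear_simps)

lemma defect_iterate: "defect n (iterate n y) = iterate n (defect n y)"
  by (simp add: iterate_apply h_commute[OF factor_in] polys_commute[OF defect_in factor_in]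
      h_commute[OF defect_in, symmetric])

text \<open>Confirms that \<open>defect n\<close> is 1 minus the square of the iterate; this links
  the two recursions.\<close>

lemma iterate_iterate: "iterate n (iterate n y) = y - defect n y"
proof (induction n arbitrary: y)
  case 0
  then show ?case by (simp add: iterate_apply k_apply)
next
  case (Suc n)
  show ?case
    by (simp add: iterate_Suc blinfun.bilinear_simps defect_iterate Suc scaleR_add_right
        scaleR_diff_right) (simp add: algebra_simps flip: scaleR_add_left)
qed

text \<open>The square of the iterate is 1 minus a positive operator.\<close>

lemma iterate_norm: "norm (iterate n y) \<le> norm y"
proof -
  have "(norm (iterate n y))\<^sup>2 = iterate n (iterate n y) \<bullet> y"
    by (simp add: power2_norm_eq_inner selfadjointD[OF iterate_selfadjoint])
  also have "\<dots> \<le> (norm y)\<^sup>2"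
    using poly_nonneg[OF defect_in[of n], of y]
    by (simp add: iterate_iterate inner_diff_left power2_norm_eq_inner)
  finally show ?thesis by (rule power2_le_imp_le) simp
qed

text \<open>The recursion in a form that passes to strong limits.\<close>

lemma iterate_cubic: "iterate (Suc n) y = (3/2) *\<^sub>R iterate n y - (1/2) *\<^sub>R iterate n (iterate n (iterate n y))"
  using scaleR_left_distrib[of 1 "1/2" "iterate n y"]
  by (simp add: iterate_Suc iterate_iterate[of n y] blinfun.bilinear_simps algebra_simps)

lemma factor_mono:
  assumes "n \<le> m"
  shows "\<exists>c \<in> op_polys {0..} k. \<forall>y. factor m y = factor n y + c y"
  using assms
proof (induction m rule: dec_induct)
  case base
  have "0 *\<^sub>R id_blinfun \<in> op_polys {0..} k" by (intro op_polys.intros) simp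
  then show ?case by force
next
  case (step m)
  then obtain c where c: "c \<in> op_polys {0..} k" "\<And>y. factor m y = factor n y + c y" by blast
  let ?d = "c + (1/2) *\<^sub>R (factor m o\<^sub>L defect m)"
  have "?d \<in> op_polys {0..} k"
    by (auto intro!: op_polys.intros op_polys_compose c factor_in defect_in)
  moreover have "factor (Suc m) y = factor n y + ?d y" for y
    using c(2)[of y] by (simp add: blinfun.bilinear_simps)
  ultimately show ?case by blast
qed

text \<open>After commuting \<open>h\<close> past the polynomials, the difference is the value at
  \<open>h y\<close> of the quadratic form of a product of two polynomials with nonnegative
  coefficients. That product is of the same kind and therefore positive.\<close>

lemma iterate_inner_mono:
  assumes "n \<le> m"
  shows "iterate n y \<bullet> iterate n y \<le> iterate m y \<bullet> iterate n y"
proof -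
  obtain c where c: "c \<in> op_polys {0..} k" "\<And>y. factor m y = factor n y + c y"
    using factor_mono[OF assms] by blast
  have "iterate m y \<bullet> iterate n y - iterate n y \<bullet> iterate n y = h (c y) \<bullet> h (factor n y)"
    by (simp add: iterate_apply c(2) blinfun.bilinear_simps inner_add_left)
  also have "\<dots> = (factor n o\<^sub>L c) (h y) \<bullet> h y"
    by (simp add: h_commute c factor_in selfadjointD[OF poly_selfadjoint[OF factor_in]])
  also have "\<dots> \<ge> 0"
    by (intro poly_nonneg op_polys_compose c factor_in)
  finally show ?thesis by simp
qed

lemma iterate_diff_norm:
  assumes "n \<le> m"
  shows "(norm (iterate m y - iterate n y))\<^sup>2 \<le> (norm (iterate m y))\<^sup>2 - (norm (iterate n y))\<^sup>2"
  using iterate_inner_mono[OF assms, of y]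
  by (simp add: power2_norm_eq_inner inner_diff_left inner_diff_right inner_commute)

text \<open>The squared norms increase and are bounded, hence Cauchy; by
  \<open>iterate_diff_norm\<close> their differences control the distances between iterates.\<close>

lemma iterate_convergent: "convergent (\<lambda>n. iterate n y)"
proof -
  have mono: "incseq (\<lambda>n. (norm (iterate n y))\<^sup>2)"
  proof (rule incseq_SucI)
    fix n
    show "(norm (iterate n y))\<^sup>2 \<le> (norm (iterate (Suc n) y))\<^sup>2"
      using iterate_diff_norm[of n "Suc n" y] zero_le_power2[of "norm (iterate (Suc n) y - iterate n y)"]
      by linarith
  qed
  have "(norm (iterate n y))\<^sup>2 \<le> (norm y)\<^sup>2" for n
    by (intro power_mono iterate_norm) simp
  with mono have "Cauchy (\<lambda>n. (norm (iterate n y))\<^sup>2)"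
    using incseq_convergent[OF mono] by (metis LIMSEQ_imp_Cauchy)
  have "Cauchy (\<lambda>n. iterate n y)"
  proof (rule metric_CauchyI)
    fix e :: real assume e: "e > 0"
    then obtain N where N: "\<And>m n. m \<ge> N \<Longrightarrow> n \<ge> N \<Longrightarrow>
        dist ((norm (iterate m y))\<^sup>2) ((norm (iterate n y))\<^sup>2) < e\<^sup>2"
      using metric_CauchyD[OF \<open>Cauchy (\<lambda>n. (norm (iterate n y))\<^sup>2)\<close>, of "e\<^sup>2"] by auto
    have *: "dist (iterate m y) (iterate n y) < e" if "n \<ge> N" "n \<le> m" for m n
    proof -
      have "(norm (iterate m y - iterate n y))\<^sup>2 < e\<^sup>2"
        using iterate_diff_norm[OF \<open>n \<le> m\<close>, of y] N[of m n] that by (simp add: dist_real_def)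
      then show ?thesis
        unfolding dist_norm by (rule power_less_imp_less_base) (use e in simp)
    qed
    have "dist (iterate m y) (iterate n y) < e" if "m \<ge> N" "n \<ge> N" for m n
      using *[of n m] *[of m n] that by (cases "n \<le> m") (auto simp: dist_commute)
    then show "\<exists>M. \<forall>m\<ge>M. \<forall>n\<ge>M. dist (iterate m y) (iterate n y) < e" by blast
  qed
  then show ?thesis by (rule Cauchy_convergent)
qed

text \<open>The limit of the cubic recursion gives w = (3 w - w^3)/2, that is w^3 = w. Norms
  increase along the iteration, which starts at \<open>h\<close>, so |h y| is at most |w y| and the
  kernel of \<open>w\<close> lies in that of \<open>h\<close>.\<close>

lemma iterate_limit:
  "\<exists>w. (\<forall>y. (\<lambda>n. iterate n y) \<longlonglongrightarrow> blinfun_apply w y) \<and> selfadjoint w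
    \<and> (\<forall>y. w (w (w y)) = w y) \<and> (\<forall>y. h (w (w y)) = h y)"
proof -
  have n1: "norm (iterate n) \<le> 1" for n
    by (rule norm_blinfun_bound) (auto simp: iterate_norm)
  obtain w where w: "\<And>y. (\<lambda>n. iterate n y) \<longlonglongrightarrow> blinfun_apply w y"
    using strong_limit_exists[OF sequentially_bot, of iterate 1] n1 iterate_convergent
    unfolding convergent_def by blast
  have sw: "selfadjoint w"
    by (rule strong_limit_selfadjoint[OF sequentially_bot iterate_selfadjoint w])
  have www: "w (w (w y)) = w y" for y
  proof -
    have "(\<lambda>n. iterate n (iterate n (iterate n y))) \<longlonglongrightarrow> w (w (w y))"
      by (rule strong_limit_compose[OF n1 w strong_limit_compose[OF n1 w w]])
    then have "(\<lambda>n. iterate (Suc n) y) \<longlonglongrightarrow> (3/2) *\<^sub>R w y - (1/2) *\<^sub>R w (w (w y))"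
      unfolding iterate_cubic by (intro tendsto_diff tendsto_scaleR tendsto_const w)
    with LIMSEQ_Suc[OF w[of y]] have "w y = (3/2) *\<^sub>R w y - (1/2) *\<^sub>R w (w (w y))"
      by (rule LIMSEQ_unique)
    then have "(1/2) *\<^sub>R w (w (w y)) = (3/2) *\<^sub>R w y - w y"
      by (metis diff_diff_eq2 add_diff_cancel_left')
    also have "\<dots> = (3/2 - 1) *\<^sub>R w y"
      by (simp only: scaleR_left_diff_distrib scaleR_one)
    finally have "(1/2) *\<^sub>R w (w (w y)) = (1/2) *\<^sub>R w y" by simp
    then show ?thesis by simp
  qed
  have "norm (h y) \<le> norm (w y)" for y
  proof (rule tendsto_lowerbound[OF tendsto_norm[OF w] always_eventually], rule allI)
    fix n
    have "(norm (h y))\<^sup>2 \<le> (norm (iterate n y))\<^sup>2"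
      using order_trans[OF zero_le_power2 iterate_diff_norm[of 0 n y]] by (simp add: iterate_apply)
    then show "norm (h y) \<le> norm (iterate n y)" by (rule power2_le_imp_le) simp
  qed simp
  \<comment> \<open>The vector y - w (w y) is killed by \<open>w\<close>, hence by
    \<open>h\<close>.\<close>
  from this[of "y - w (w y)" for y] have "h (w (w y)) = h y" for y
    by (simp add: blinfun.bilinear_simps www)
  with w sw www show ?thesis by blast
qed

end

text \<open>The approximants \<open>h o\<^sub>L Q n\<close> are recorded along with the sign
  \<open>w\<close>. They lie in any ideal that contains \<open>h\<close>, as long as the algebra
  contains the \<open>Q n\<close>; being polynomials in h^2, the \<open>Q n\<close> commute with
  everything that commutes with h^2.\<close>

lemma sign_operator:
  fixes h :: "'h::complex_hilbert_space \<Rightarrow>\<^sub>L 'h"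
  assumes hb: "h \<in> bounded_ops" and sa: "selfadjoint h"
  shows "\<exists>w Q. selfadjoint w \<and> w o\<^sub>L w o\<^sub>L w = w \<and> w o\<^sub>L w o\<^sub>L h = h
    \<and> (\<forall>n::nat. Q n \<in> op_polys UNIV (h o\<^sub>L h)) \<and> (\<forall>n. norm (h o\<^sub>L Q n) \<le> 1)
    \<and> (\<forall>y. (\<lambda>n. blinfun_apply (h o\<^sub>L Q n) y) \<longlonglongrightarrow> blinfun_apply w y)"
proof -
  \<comment> \<open>Scaling by a positive number makes \<open>h\<close> a contraction; the added 1
    covers h = 0.\<close>
  define r where "r = 1 / (norm h + 1)"
  have r: "r > 0" by (simp add: r_def add_nonneg_pos)
  interpret newton_iteration "r *\<^sub>R h"
  proof
    show "selfadjoint (r *\<^sub>R h)" using sa by (simp add: selfadjoint_def blinfun.bilinear_simps)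
    show "norm (r *\<^sub>R h) \<le> 1" unfolding r_def using norm_ge_zero[of h] by (simp add: divide_le_eq_1 add_nonneg_pos)
  qed
  obtain w where w: "\<And>y. (\<lambda>n. iterate n y) \<longlonglongrightarrow> blinfun_apply w y" "selfadjoint w"
    "\<And>y. w (w (w y)) = w y" "\<And>y. (r *\<^sub>R h) (w (w y)) = (r *\<^sub>R h) y"
    using iterate_limit by blast
  have hw: "h (w (w y)) = h y" for y
    using w(4)[of y] r by (simp add: blinfun.bilinear_simps)
  \<comment> \<open>The adjoint of the relation h w^2 = h.\<close>
  have "w (w (h y)) = h y" for y
    by (rule inner_ext) (simp add: selfadjointD[OF w(2)] selfadjointD[OF assms(2)] hw)
  moreover define Q where "Q n = r *\<^sub>R factor n" for n
  have Q: "h o\<^sub>L Q n = iterate n" for n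
    by (rule blinfun_eqI) (simp add: Q_def iterate_apply blinfun.bilinear_simps)
  moreover have "norm (iterate n) \<le> 1" for n
    by (rule norm_blinfun_bound) (auto simp: iterate_norm)
  \<comment> \<open>Here k = 1 - r^2 h^2, an affine function of h^2.\<close>
  moreover have "factor n \<in> op_polys UNIV (h o\<^sub>L h)" for n
    by (rule op_polys_change[OF _ factor_in, where r = "- r\<^sup>2"])
      (simp add: k_apply blinfun.bilinear_simps power2_eq_square)
  then have "Q n \<in> op_polys UNIV (h o\<^sub>L h)" for n
    by (simp add: Q_def op_polys.scaleR)
  ultimately show ?thesis
    using w by (intro exI[of _ w] exI[of _ Q]) (auto intro!: blinfun_eqI)
qed


section \<open>Von Neumann algebras\<close>

locale von_neumann =
  fixes A :: "('h::complex_hilbert_space \<Rightarrow>\<^sub>L 'h) set"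
  assumes vN: "von_neumann_algebra A"
begin

lemma bounded: "a \<in> A \<Longrightarrow> a \<in> bounded_ops"
  using vN unfolding von_neumann_algebra_def by blast

lemma id_mem: "id_blinfun \<in> A"
  using vN by (simp add: von_neumann_algebra_def)

lemma add_mem: "a \<in> A \<Longrightarrow> b \<in> A \<Longrightarrow> a + b \<in> A"
  using vN by (simp add: von_neumann_algebra_def)

lemma compose_mem: "a \<in> A \<Longrightarrow> b \<in> A \<Longrightarrow> a o\<^sub>L b \<in> A"
  using vN by (simp add: von_neumann_algebra_def)

lemma scale_mem: "a \<in> A \<Longrightarrow> scale_op c a \<in> A"
  using vN by (simp add: von_neumann_algebra_def)

lemma adj_mem: "a \<in> A \<Longrightarrow> adj a \<in> A"
  using vN by (simp add: von_neumann_algebra_def)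

lemma scaleR_mem: "a \<in> A \<Longrightarrow> r *\<^sub>R a \<in> A"
  by (simp add: scaleR_eq_scale_op scale_mem)

lemma diff_mem: "a \<in> A \<Longrightarrow> b \<in> A \<Longrightarrow> a - b \<in> A"
  using add_mem[of a "(-1) *\<^sub>R b"] scaleR_mem[of b "-1"] by simp

lemma zero_mem: "0 \<in> A"
  using diff_mem[OF id_mem id_mem] by simp

lemma ultraweakly_closed: "closedin ultraweak_topology A"
  by (rule closedin_weak_imp_ultraweak) (use vN in \<open>simp add: von_neumann_algebra_def\<close>)

lemma two_sided_ideal_self: "two_sided_ideal A A"
  by (simp add: two_sided_ideal_def zero_mem add_mem scale_mem compose_mem)

lemma op_polys_mem: "c \<in> op_polys S g \<Longrightarrow> g \<in> A \<Longrightarrow> c \<in> A"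
  by (induction rule: op_polys.induct) (simp_all add: id_mem add_mem scaleR_mem compose_mem)

text \<open>With \<open>w\<close> the sign of x \<open>adj x\<close>, the projection is p = w^2. The
  approximants of \<open>w\<close> are left multiples of polynomials by x \<open>adj x\<close>: they
  stay in every ideal containing \<open>x\<close> and are fixed by every \<open>e\<close> with e x =
  x, and both properties survive the limit.\<close>

lemma range_projection:
  assumes x: "x \<in> A"
  shows "\<exists>p\<in>A. projection p \<and> p o\<^sub>L x = x
    \<and> (\<forall>J. two_sided_ideal A J \<longrightarrow> closedin ultraweak_topology J \<longrightarrow> x \<in> J \<longrightarrow> p \<in> J)
    \<and> (\<forall>e. e o\<^sub>L x = x \<longrightarrow> e o\<^sub>L p = p)"
proof -
  define h where "h = x o\<^sub>L adj x"
  have xb: "x \<in> bounded_ops" by (rule bounded[OF x])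
  have hA: "h \<in> A" unfolding h_def by (intro compose_mem adj_mem x)
  have sa: "selfadjoint h"
    unfolding selfadjoint_def h_def using inner_adj[OF xb] inner_adj'[OF xb] by simp
  obtain w Q where sw: "selfadjoint w" and www: "w o\<^sub>L w o\<^sub>L w = w" and wwh: "w o\<^sub>L w o\<^sub>L h = h"
    and Q: "\<And>n::nat. Q n \<in> op_polys UNIV (h o\<^sub>L h)" and n1: "\<And>n. norm (h o\<^sub>L Q n) \<le> 1"
    and lim: "\<And>y. (\<lambda>n. blinfun_apply (h o\<^sub>L Q n) y) \<longlonglongrightarrow> blinfun_apply w y"
    using sign_operator[OF bounded[OF hA] sa] by blast
  have QA: "Q n \<in> A" for n
    using op_polys_mem[OF Q] compose_mem[OF hA hA] by blast
  have wJ: "w \<in> J"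
    if J: "two_sided_ideal A J" "closedin ultraweak_topology J" "x \<in> J" for J
  proof (rule ultraweakly_closed_strong_limit[OF J(2) sequentially_bot n1 _ lim])
    have "h \<in> J" using J(1,3) adj_mem[OF x] unfolding h_def two_sided_ideal_def by blast
    then show "h o\<^sub>L Q n \<in> J" for n using J(1) QA unfolding two_sided_ideal_def by blast
  qed
  \<comment> \<open>The algebra is itself an ultraweakly closed ideal containing
    \<open>x\<close>.\<close>
  have wA: "w \<in> A" by (rule wJ[OF two_sided_ideal_self ultraweakly_closed x])
  define p where "p = w o\<^sub>L w"
  have www': "w (w (w y)) = w y" for y
    using www by (metis blinfun_apply_blinfun_compose)
  have pA: "p \<in> A" unfolding p_def by (intro compose_mem wA)
  have "projection p"
    unfolding projection_def
  proof (intro conjI)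
    show "p \<in> bounded_ops" by (rule bounded[OF pA])
    show sp: "selfadjoint p" using sw by (simp add: selfadjoint_def p_def)
    show "p o\<^sub>L p = p" by (rule blinfun_eqI) (simp add: p_def www')
  qed
  moreover have "p o\<^sub>L x = x"
  proof (rule blinfun_eqI)
    fix u
    define d where "d = id_blinfun - p"
    have d: "d v = v - p v" for v by (simp add: d_def blinfun.bilinear_simps)
    have sd: "d v \<bullet> z = v \<bullet> d z" for v z
      using sw by (simp add: d p_def inner_diff_left inner_diff_right selfadjointD)
    have dh: "d (h v) = 0" for v
      using wwh by (simp add: d p_def) (metis blinfun_apply_blinfun_compose)
    \<comment> \<open>With d = 1 - p, the squared norm of this vector is the inner product of d h d
      z with z, and d h = 0. Taking adjoints yields d x = 0.\<close>
    have "adj x (d z) = 0" for z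
    proof -
      have "adj x (d z) \<bullet> adj x (d z) = h (d z) \<bullet> d z"
        unfolding h_def by (simp add: inner_adj[OF xb])
      also have "\<dots> = d (h (d z)) \<bullet> z" by (rule sd[symmetric])
      finally show ?thesis by (simp add: dh)
    qed
    then have "d (x u) \<bullet> z = 0" for z
      unfolding sd inner_adj[OF xb] by simp
    then have "d (x u) = 0" by (metis inner_eq_zero_iff)
    then show "(p o\<^sub>L x) u = x u" by (simp add: d)
  qed
  moreover have "p \<in> J"
    if "two_sided_ideal A J" "closedin ultraweak_topology J" "x \<in> J" for J
    using wJ[OF that] that(1) wA unfolding p_def two_sided_ideal_def by blast
  moreover have "e o\<^sub>L p = p" if e: "e o\<^sub>L x = x" for e
  proof (rule blinfun_eqI)
    fix y
    have "e (h z) = h z" for z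
      using e unfolding h_def by (metis blinfun_apply_blinfun_compose)
    then have "(\<lambda>n. e (blinfun_apply (h o\<^sub>L Q n) z)) \<longlonglongrightarrow> w z" for z
      using lim[of z] by simp
    moreover have "(\<lambda>n. e (blinfun_apply (h o\<^sub>L Q n) z)) \<longlonglongrightarrow> e (w z)" for z
      by (rule bounded_linear.tendsto[OF blinfun.bounded_linear_right lim])
    ultimately have "e (w z) = w z" for z by (metis LIMSEQ_unique)
    then show "(e o\<^sub>L p) y = p y" by (simp add: p_def)
  qed
  ultimately show ?thesis using pA by blast
qed

text \<open>
  For \<open>x = e a (1 - e)\<close> nonzero, the sign \<open>w\<close> of \<open>x + x\<^sup>*\<close> exchanges the subprojections
  \<open>e w\<^sup>2\<close> and \<open>(1 - e) w\<^sup>2\<close>; it extends to the unitary \<open>w + 1 - w\<^sup>2\<close>.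
\<close>

lemma noncentral_projection_swap:
  assumes e: "projection e" "e \<in> A" and a: "a \<in> A" "e o\<^sub>L a \<noteq> a o\<^sub>L e"
  shows "\<exists>u\<in>A. \<exists>q\<in>A. unitary u \<and> projection q \<and> q \<noteq> 0 \<and> e o\<^sub>L q = q \<and> q o\<^sub>L e = q
    \<and> e o\<^sub>L Ad u q = 0 \<and> Ad u q o\<^sub>L e = 0"
proof -
  have ee: "e (e y) = e y" for y by (rule projection_apply_twice[OF e(1)])
  have se: "e x \<bullet> y = x \<bullet> e y" for x y
    using e(1) by (simp add: projection_def selfadjointD)
  \<comment> \<open>A nonzero element of the corner from the range of 1 - e to the range of
    \<open>e\<close>. If that corner of \<open>a\<close> vanishes, the corresponding corner of
    \<open>adj a\<close> is used.\<close>
  have "\<exists>x\<in>A. x \<noteq> 0 \<and> (\<forall>y. e (blinfun_apply x y) = x y) \<and> (\<forall>y. x (e y) = 0)"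
  proof (cases "\<forall>y. e (a y) = e (a (e y))")
    case False
    define x where "x = e o\<^sub>L a o\<^sub>L (id_blinfun - e)"
    have "x y = e (a y) - e (a (e y))" for y
      by (simp add: x_def blinfun.bilinear_simps)
    moreover have "x \<in> A" unfolding x_def by (intro compose_mem diff_mem id_mem e a)
    ultimately show ?thesis
      using False by (intro bexI[of _ x]) (auto simp: blinfun.bilinear_simps ee)
  next
    case True
    define x where "x = e o\<^sub>L adj a o\<^sub>L (id_blinfun - e)"
    have x: "x y = e (adj a y) - e (adj a (e y))" for y
      by (simp add: x_def blinfun.bilinear_simps)
    \<comment> \<open>Otherwise a e = e a e by adjoints, and e a = e a e in the present case, so
      \<open>a\<close> would commute with \<open>e\<close>.\<close>
    have "x \<noteq> 0"
    proof
      assume "x = 0"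
      have "a (e z) = e (a (e z))" for z
      proof (rule inner_ext)
        fix y
        have "e (adj a y) = e (adj a (e y))"
          using x[of y] \<open>x = 0\<close> by simp
        then have "z \<bullet> e (adj a y) = z \<bullet> e (adj a (e y))" by simp
        then show "a (e z) \<bullet> y = e (a (e z)) \<bullet> y"
          by (simp only: se inner_adj[OF bounded[OF a(1)]])
      qed
      then have "e o\<^sub>L a = a o\<^sub>L e"
        using True by (intro blinfun_eqI) simp
      with a show False by simp
    qed
    moreover have "x \<in> A" unfolding x_def by (intro compose_mem diff_mem id_mem e a adj_mem)
    ultimately show ?thesis
      using x by (intro bexI[of _ x]) (auto simp: blinfun.bilinear_simps ee)
  qed
  then obtain x where x: "x \<in> A" "x \<noteq> 0" "\<And>y. e (blinfun_apply x y) = x y" "\<And>y. x (e y) = 0" by blast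
  have xb: "x \<in> bounded_ops" by (rule bounded[OF x(1)])
  have x': "e (adj x y) = 0" "adj x (e y) = adj x y" for y
    by (rule inner_ext, simp add: se inner_adj'[OF xb] x)+
  define h where "h = x + adj x"
  have h: "h y = x y + adj x y" for y by (simp add: h_def blinfun.bilinear_simps)
  have hA: "h \<in> A" unfolding h_def by (intro add_mem adj_mem x)
  have sa: "selfadjoint h"
    by (simp add: selfadjoint_def h inner_add_left inner_add_right inner_adj[OF xb] inner_adj'[OF xb])
  \<comment> \<open>\<open>h\<close> is off-diagonal with respect to \<open>e\<close>, so it
    exchanges the ranges of \<open>e\<close> and 1 - e. Hence \<open>e\<close> commutes with h^2 and
    with each \<open>Q n\<close>, and the exchange relation passes to \<open>w\<close>.\<close>
  have eh: "e (h y) = h y - h (e y)" for y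
    by (simp add: h blinfun.bilinear_simps x x')
  obtain w Q where sw: "selfadjoint w" and www: "w o\<^sub>L w o\<^sub>L w = w" and wwh: "w o\<^sub>L w o\<^sub>L h = h"
    and Q: "\<And>n::nat. Q n \<in> op_polys UNIV (h o\<^sub>L h)" and n1: "\<And>n. norm (h o\<^sub>L Q n) \<le> 1"
    and lim: "\<And>y. (\<lambda>n. blinfun_apply (h o\<^sub>L Q n) y) \<longlonglongrightarrow> blinfun_apply w y"
    using sign_operator[OF bounded[OF hA] sa] by blast
  have QA: "Q n \<in> A" for n
    using op_polys_mem[OF Q] compose_mem[OF hA hA] by blast
  have wA: "w \<in> A"
    by (rule ultraweakly_closed_strong_limit[OF ultraweakly_closed sequentially_bot n1 _ lim])
      (intro compose_mem hA QA)
  have www': "w (w (w y)) = w y" for y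
    using www by (metis blinfun_apply_blinfun_compose)
  have eQ: "e (Q n y) = Q n (e y)" for n y
    by (rule op_polys_commute[OF Q]) (simp add: eh blinfun.bilinear_simps)
  have ew: "e (w y) = w y - w (e y)" for y
  proof (rule LIMSEQ_unique)
    show "(\<lambda>n. e ((h o\<^sub>L Q n) y)) \<longlonglongrightarrow> e (w y)"
      by (rule bounded_linear.tendsto[OF blinfun.bounded_linear_right lim])
    show "(\<lambda>n. e ((h o\<^sub>L Q n) y)) \<longlonglongrightarrow> w y - w (e y)"
      using tendsto_diff[OF lim[of y] lim[of "e y"]] by (simp add: eh eQ)
  qed
  define p where "p = w o\<^sub>L w"
  have p: "p y = w (w y)" for y by (simp add: p_def)
  have pA: "p \<in> A" unfolding p_def by (intro compose_mem wA)
  have ep: "e (p y) = p (e y)" for y by (simp add: p ew blinfun.bilinear_simps)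
  define u where "u = w + id_blinfun - p"
  have u: "u y = w y + y - p y" for y by (simp add: u_def blinfun.bilinear_simps)
  have uA: "u \<in> A" unfolding u_def by (intro add_mem diff_mem id_mem wA pA)
  have "selfadjoint u"
    using sw by (simp add: selfadjoint_def u p inner_add_left inner_add_right inner_diff_left inner_diff_right)
  then have au: "adj u = u" by (rule adj_selfadjoint) (rule bounded[OF uA])
  have "u o\<^sub>L u = id_blinfun"
    by (rule blinfun_eqI) (simp add: u p blinfun.bilinear_simps www')
  then have "unitary u" by (simp add: unitary_def au)
  define q where "q = e o\<^sub>L p"
  have q: "q y = e (p y)" for y by (simp add: q_def)
  have qA: "q \<in> A" unfolding q_def by (intro compose_mem e pA)
  have sq: "selfadjoint q"
    using sw unfolding selfadjoint_def by (simp only: q se p) (simp add: ep flip: p)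
  have "projection q"
    unfolding projection_def
  proof (intro conjI sq)
    show "q \<in> bounded_ops" by (rule bounded[OF qA])
    show "q o\<^sub>L q = q"
      by (rule blinfun_eqI) (simp add: q ep[symmetric] ee, simp add: p www')
  qed
  moreover have "q \<noteq> 0"
  proof
    assume "q = 0"
    then have ep0: "e (p y) = 0" for y by (simp flip: q)
    \<comment> \<open>From e w^2 = 0 and w^3 = w both e w and w e vanish, so w = e w + w e = 0. Then
      h = w^2 h = 0, which contradicts the choice of \<open>x\<close>.\<close>
    have "e (w y) = 0" for y using ep0[of "w y"] by (simp add: p www')
    moreover have "w (e y) = 0" for y
    proof -
      have "w (e y) = w (p (e y))" by (simp only: p www')
      also have "p (e y) = 0" using ep0[of y] by (simp only: ep)
      finally show ?thesis by (simp add: blinfun.zero_right)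
    qed
    ultimately have "w y = 0" for y using ew[of y] by simp
    then have "h y = 0" for y
      using wwh by (metis blinfun_apply_blinfun_compose blinfun.zero_right)
    then have "e (h y) = 0" for y by (simp add: blinfun.zero_right)
    then have "x y = 0" for y by (simp add: h blinfun.bilinear_simps x x')
    then have "x = 0" by (intro blinfun_eqI) simp
    with x show False by simp
  qed
  moreover have "e o\<^sub>L q = q" by (rule blinfun_eqI) (simp add: q ee)
  moreover have "q o\<^sub>L e = q" by (rule blinfun_eqI) (simp add: q ep[symmetric] ee)
  moreover have eAd: "e (Ad u q y) = 0" for y
  proof -
    \<comment> \<open>On the range of \<open>q\<close> the unitary acts as \<open>w\<close>, which
      maps it into the range of 1 - e.\<close>
    have "u (e (p z)) = w (e (p z))" for z
      by (simp add: u ep) (simp add: p www')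
    then show ?thesis
      by (simp add: Ad_def au q ew ee blinfun.bilinear_simps)
  qed
  moreover have "Ad u q (e y) = 0" for y
  proof -
    have "Ad u q (e y) \<bullet> z = y \<bullet> e (Ad u q z)" for z
      using sq \<open>selfadjoint u\<close> by (simp add: Ad_def au se selfadjointD)
    then show ?thesis by (metis eAd inner_zero_right inner_eq_zero_iff)
  qed
  ultimately show ?thesis
    using uA qA \<open>unitary u\<close>
    by (intro bexI[of _ u] bexI[of _ q]) (auto intro!: blinfun_eqI)
qed

end


section \<open>Commutative subalgebras\<close>

definition commutant :: "('h::complex_hilbert_space \<Rightarrow>\<^sub>L 'h) set \<Rightarrow> ('h \<Rightarrow>\<^sub>L 'h) set"
  where "commutant S = {a \<in> bounded_ops. \<forall>s\<in>S. a o\<^sub>L s = s o\<^sub>L a}"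

lemma commutantI:
  "a \<in> bounded_ops \<Longrightarrow> (\<And>s y. s \<in> S \<Longrightarrow> a (blinfun_apply s y) = s (a y)) \<Longrightarrow> a \<in> commutant S"
  unfolding commutant_def by (simp add: blinfun_eqI)

lemma commutantD:
  "a \<in> commutant S \<Longrightarrow> s \<in> S \<Longrightarrow> a (blinfun_apply s y) = s (a y)"
proof -
  assume "a \<in> commutant S" "s \<in> S"
  then have "a o\<^sub>L s = s o\<^sub>L a" by (simp add: commutant_def)
  then show ?thesis by (metis blinfun_apply_blinfun_compose)
qed

lemma von_neumann_commutant:
  assumes S: "S \<subseteq> bounded_ops" "\<And>s. s \<in> S \<Longrightarrow> adj s \<in> S"
  shows "von_neumann_algebra (commutant S)"
  unfolding von_neumann_algebra_def
proof (intro conjI ballI allI)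
  show "commutant S \<subseteq> bounded_ops" by (auto simp: commutant_def)
  show "id_blinfun \<in> commutant S" by (rule commutantI) simp_all
  show "closedin weak_op_topology (commutant S)"
    unfolding commutant_def by (rule closedin_weak_commutant[OF S(1)])
  fix a assume a: "a \<in> commutant S"
  then have ab: "a \<in> bounded_ops" by (simp add: commutant_def)
  show "scale_op c a \<in> commutant S" for c
    by (rule commutantI)
      (use S(1) in \<open>auto simp: ab scale_op.rep_eq commutantD[OF a] bounded_opsD\<close>)
  show "adj a \<in> commutant S"
  proof (rule commutantI)
    fix s y assume s: "s \<in> S"
    then have sb: "s \<in> bounded_ops" using S by blast
    show "adj a (s y) = s (adj a y)"
    proof (rule inner_ext)
      fix z
      have "adj a (s y) \<bullet> z = y \<bullet> adj s (a z)"
        by (simp add: inner_adj'[OF ab] inner_adj[OF sb])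
      also have "\<dots> = y \<bullet> a (adj s z)"
        by (simp add: commutantD[OF a S(2)[OF s]])
      also have "\<dots> = s (adj a y) \<bullet> z"
        by (simp add: inner_adj'[OF ab] inner_adj[OF sb])
      finally show "adj a (s y) \<bullet> z = s (adj a y) \<bullet> z" .
    qed
  qed (simp add: ab)
  fix b assume b: "b \<in> commutant S"
  then have bb: "b \<in> bounded_ops" by (simp add: commutant_def)
  show "a + b \<in> commutant S" "a o\<^sub>L b \<in> commutant S"
    by (rule commutantI; simp add: ab bb commutantD[OF a] commutantD[OF b] blinfun.bilinear_simps)+
qed

lemma von_neumann_Int:
  "von_neumann_algebra A \<Longrightarrow> von_neumann_algebra B \<Longrightarrow> von_neumann_algebra (A \<inter> B)"
  unfolding von_neumann_algebra_def by (simp add: closedin_Int le_infI1)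

lemma comm_subalgebras_Int:
  "V \<in> comm_subalgebras A \<Longrightarrow> W \<in> comm_subalgebras A \<Longrightarrow> V \<inter> W \<in> comm_subalgebras A"
  unfolding comm_subalgebras_def by (simp add: von_neumann_Int le_infI1)

text \<open>Intersect the bicommutant of \<open>S\<close> with \<open>A\<close>. Since
  \<open>S\<close> is commutative it lies in its commutant \<open>C\<close>, so the commutant of
  \<open>C\<close> lies in \<open>C\<close> as well and is therefore commutative.\<close>

lemma (in von_neumann) comm_subalgebra_containing:
  assumes S: "S \<subseteq> A" "\<And>s. s \<in> S \<Longrightarrow> selfadjoint s"
    and comm: "\<And>s t. s \<in> S \<Longrightarrow> t \<in> S \<Longrightarrow> s o\<^sub>L t = t o\<^sub>L s"
  shows "\<exists>V\<in>comm_subalgebras A. S \<subseteq> V"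
proof -
  define C where "C = commutant S"
  have Sb: "S \<subseteq> bounded_ops" using S(1) bounded by blast
  have "adj s \<in> S" if "s \<in> S" for s
    using adj_selfadjoint[OF S(2)[OF that]] Sb that by auto
  then have C: "von_neumann_algebra C"
    unfolding C_def by (rule von_neumann_commutant[OF Sb])
  then have CC: "von_neumann_algebra (commutant C)"
    by (intro von_neumann_commutant) (auto simp: von_neumann_algebra_def)
  have SC: "S \<subseteq> C" unfolding C_def commutant_def using Sb comm by blast
  have "S \<subseteq> commutant C"
    unfolding commutant_def using Sb unfolding C_def commutant_def by fastforce
  moreover have "a o\<^sub>L b = b o\<^sub>L a" if "a \<in> commutant C" "b \<in> commutant C" for a b
  proof -
    have "b \<in> C" using that(2) SC unfolding C_def by (force simp: commutant_def)
    with that(1) show ?thesis by (simp add: commutant_def)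
  qed
  ultimately have "A \<inter> commutant C \<in> comm_subalgebras A \<and> S \<subseteq> A \<inter> commutant C"
    using von_neumann_Int[OF vN CC] S(1) by (auto simp: comm_subalgebras_def)
  then show ?thesis by blast
qed

section \<open>Conjugation by unitaries\<close>

lemma Ad_apply: "Ad u a y = u (a (adj u y))"
  by (simp add: Ad_def)

lemma unitary_adj_apply: "unitary u \<Longrightarrow> u (adj u y) = y" "unitary u \<Longrightarrow> adj u (u y) = y"
  unfolding unitary_def by (metis blinfun_apply_blinfun_compose blinfun_apply_id_blinfun id_apply)+

text \<open>The vector functional at x, y composed with \<open>Ad u\<close> is the vector functional
  at \<open>adj u x\<close>, \<open>adj u y\<close>.\<close>

lemma continuous_map_Ad:
  assumes u: "u \<in> bounded_ops"
  shows "continuous_map weak_op_topology weak_op_topology (Ad u)"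
  unfolding weak_op_topology_def
proof (rule continuous_map_op_topology)
  show "a \<in> bounded_ops \<Longrightarrow> Ad u a \<in> bounded_ops" for a
    using u by (simp add: Ad_def)
  fix \<phi> :: "('a \<Rightarrow>\<^sub>L 'a) \<Rightarrow> complex"
  assume "\<phi> \<in> {\<lambda>a. cinner (blinfun_apply a x) y | x y. True}"
  then obtain x y where \<phi>: "\<phi> = (\<lambda>a. cinner (blinfun_apply a x) y)" by blast
  show "\<exists>\<psi>\<in>{\<lambda>a. cinner (blinfun_apply a x) y | x y. True}. \<forall>a\<in>bounded_ops. \<phi> (Ad u a) = \<psi> a"
  proof (intro bexI ballI)
    show "\<phi> (Ad u a) = cinner (blinfun_apply a (adj u x)) (adj u y)" for a
      by (simp add: \<phi> Ad_apply cinner_adj[OF u])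
  qed blast
qed

lemma (in von_neumann) Ad_comm_subalgebra:
  assumes V: "V \<in> comm_subalgebras A" and u: "u \<in> A" "unitary u"
  shows "Ad u ` V \<in> comm_subalgebras A"
proof -
  have ub: "u \<in> bounded_ops" by (rule bounded[OF u(1)])
  have VA: "V \<subseteq> A" using V by (simp add: comm_subalgebras_def)
  interpret V: von_neumann V
    by unfold_locales (use V in \<open>simp add: comm_subalgebras_def\<close>)
  note uu = unitary_adj_apply[OF u(2)]
  have inv: "Ad (adj u) (Ad u a) = a" "Ad u (Ad (adj u) a) = a" for a
    by (rule blinfun_eqI, simp add: Ad_apply ub uu)+
  have AdA: "Ad u ` V \<subseteq> A"
    using VA u unfolding Ad_def by (auto intro!: compose_mem adj_mem)
  \<comment> \<open>The image is written as a preimage under the inverse conjugation, so that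
    continuity gives its closedness.\<close>
  have "Ad u ` V = {b \<in> topspace weak_op_topology. Ad (adj u) b \<in> V}"
  proof (intro equalityI subsetI)
    fix b assume "b \<in> Ad u ` V"
    then show "b \<in> {b \<in> topspace weak_op_topology. Ad (adj u) b \<in> V}"
      using AdA bounded by (auto simp: inv weak_op_topology_def)
  next
    fix b assume "b \<in> {b \<in> topspace weak_op_topology. Ad (adj u) b \<in> V}"
    then show "b \<in> Ad u ` V"
      using inv(2)[of b] by (metis (mono_tags, lifting) imageI mem_Collect_eq)
  qed
  then have closed: "closedin weak_op_topology (Ad u ` V)"
    using closedin_continuous_map_preimage[OF continuous_map_Ad[of "adj u"]] ub V.vN
    by (simp add: von_neumann_algebra_def)
  have ops: "id_blinfun = Ad u id_blinfun" "Ad u a + Ad u b = Ad u (a + b)"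
    "scale_op c (Ad u a) = Ad u (scale_op c a)" "Ad u a o\<^sub>L Ad u b = Ad u (a o\<^sub>L b)" for a b c
    by (rule blinfun_eqI, simp add: Ad_apply uu blinfun.bilinear_simps scale_op.rep_eq bounded_opsD[OF ub])+
  have adj: "adj (Ad u a) = Ad u (adj a)" if "a \<in> bounded_ops" for a
    using that ub by (simp add: Ad_def adj_compose blinfun_compose_assoc)
  have "von_neumann_algebra (Ad u ` V)"
    unfolding von_neumann_algebra_def
  proof (intro conjI ballI allI closed)
    show "Ad u ` V \<subseteq> bounded_ops" using AdA bounded by blast
    show "id_blinfun \<in> Ad u ` V" using ops(1) V.id_mem by blast
    fix a assume "a \<in> Ad u ` V"
    then obtain a' where a: "a = Ad u a'" "a' \<in> V" by blast
    show "scale_op c a \<in> Ad u ` V" for c using a ops(3) V.scale_mem by blast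
    show "adj a \<in> Ad u ` V" using a adj V.adj_mem V.bounded by auto
    fix b assume "b \<in> Ad u ` V"
    then obtain b' where b: "b = Ad u b'" "b' \<in> V" by blast
    show "a + b \<in> Ad u ` V" using a b ops(2) V.add_mem by blast
    show "a o\<^sub>L b \<in> Ad u ` V" using a b ops(4) V.compose_mem by blast
  qed
  moreover have "\<forall>a\<in>V. \<forall>b\<in>V. a o\<^sub>L b = b o\<^sub>L a" using V by (simp add: comm_subalgebras_def)
  then have "\<forall>a\<in>Ad u ` V. \<forall>b\<in>Ad u ` V. a o\<^sub>L b = b o\<^sub>L a" by (auto simp: ops(4))
  ultimately show ?thesis using AdA by (simp add: comm_subalgebras_def)
qed


section \<open>Limits of chains of projections\<close>

text \<open>The equation \<open>q o\<^sub>L p = p\<close> encodes p \<le> q. Under it q y - p y is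
  orthogonal to p y, and the identity is Pythagoras.\<close>

lemma projection_le_norm:
  assumes p: "projection p" and q: "projection q" and le: "q o\<^sub>L p = p"
  shows "(norm (q y - p y))\<^sup>2 = (norm (q y))\<^sup>2 - (norm (p y))\<^sup>2"
proof -
  have "q y \<bullet> p y = y \<bullet> q (p y)"
    using q by (simp add: projection_def selfadjointD)
  also have "\<dots> = y \<bullet> p (p y)"
    using le projection_apply_twice[OF p] by (metis blinfun_apply_blinfun_compose)
  also have "\<dots> = p y \<bullet> p y"
    using p by (simp add: projection_def selfadjointD)
  finally show ?thesis
    by (simp add: power2_norm_eq_inner inner_diff_left inner_diff_right inner_commute)
qed

lemma projection_le_commute:
  assumes p: "projection p" and q: "projection q" and le: "q o\<^sub>L p = p"
  shows "p o\<^sub>L q = p"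
proof -
  have "adj (q o\<^sub>L p) = adj p o\<^sub>L adj q"
    using p q by (simp add: adj_compose projection_def)
  then show ?thesis using le p q by (simp add: projection_adj)
qed

lemma projection_le_trans: "r o\<^sub>L q = q \<Longrightarrow> q o\<^sub>L p = p \<Longrightarrow> r o\<^sub>L p = p"
  by (metis blinfun_compose_assoc)

text \<open>The supremum is a strong limit along the chain. The chain need not be countable, so a
  filter of its upper tails replaces a sequence.\<close>

lemma projection_chain_limit:
  fixes C :: "('h::complex_hilbert_space \<Rightarrow>\<^sub>L 'h) set"
  assumes ne: "C \<noteq> {}" and proj: "\<And>p. p \<in> C \<Longrightarrow> projection p"
    and chain: "\<And>p q. p \<in> C \<Longrightarrow> q \<in> C \<Longrightarrow> q o\<^sub>L p = p \<or> p o\<^sub>L q = q"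
  shows "\<exists>E. projection E \<and> (\<forall>p\<in>C. E o\<^sub>L p = p) \<and> (\<forall>J. closedin ultraweak_topology J \<longrightarrow> C \<subseteq> J \<longrightarrow> E \<in> J)"
proof -
  define F where "F = (INF p\<in>C. principal {q \<in> C. q o\<^sub>L p = p})"
  have refl: "p o\<^sub>L p = p" if "p \<in> C" for p using proj[OF that] by (simp add: projection_def)
  have ev: "eventually P F \<longleftrightarrow> (\<exists>p\<in>C. \<forall>q\<in>C. q o\<^sub>L p = p \<longrightarrow> P q)" for P
    unfolding F_def
  proof (subst eventually_INF_base[OF ne])
    fix p q assume pq: "p \<in> C" "q \<in> C"
    show "\<exists>r\<in>C. principal {s \<in> C. s o\<^sub>L r = r} \<le> inf (principal {s \<in> C. s o\<^sub>L p = p}) (principal {s \<in> C. s o\<^sub>L q = q})"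
    proof (cases "q o\<^sub>L p = p")
      case True
      then show ?thesis using pq by (intro bexI[of _ q]) (auto intro: projection_le_trans)
    next
      case False
      then have "p o\<^sub>L q = q" using chain pq by blast
      then show ?thesis using pq by (intro bexI[of _ p]) (auto intro: projection_le_trans)
    qed
  qed (auto simp: eventually_principal)
  have F: "F \<noteq> bot"
    unfolding trivial_limit_def ev using refl by blast
  obtain p0 where p0: "p0 \<in> C" using ne by blast
  \<comment> \<open>The default \<open>p0\<close> keeps every value in \<open>C\<close>, so that the
    norm bound and membership hold for all indices; the filter is concentrated on \<open>C\<close>,
    so limits do not change.\<close>
  define a where "a q = (if q \<in> C then q else p0)" for q
  have aC: "a q \<in> C" for q using p0 by (simp add: a_def)
  have a1: "norm (a q) \<le> 1" for q by (rule projection_norm_le[OF proj[OF aC]])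
  have "\<exists>l. ((\<lambda>q. a q y) \<longlongrightarrow> l) F" for y
  proof -
    \<comment> \<open>Once the squared norm of p y is within (e/2)^2 of this supremum, Pythagoras
      keeps q y within e/2 of p y for all larger \<open>q\<close>.\<close>
    define S where "S = Sup ((\<lambda>p. (norm (blinfun_apply p y))\<^sup>2) ` C)"
    have "(norm (p y))\<^sup>2 \<le> (norm y)\<^sup>2" if "p \<in> C" for p
    proof -
      have "norm (p y) \<le> norm p * norm y" by (rule norm_blinfun)
      also have "\<dots> \<le> 1 * norm y"
        by (intro mult_right_mono projection_norm_le proj that norm_ge_zero)
      finally show ?thesis by (simp add: power_mono)
    qed
    then have bdd: "bdd_above ((\<lambda>p. (norm (blinfun_apply p y))\<^sup>2) ` C)"
      by (intro bdd_aboveI2)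
    have "cauchy_filter (filtermap (\<lambda>q. a q y) F)"
      unfolding cauchy_filter_metric_filtermap
    proof (intro allI impI)
      fix e :: real assume e: "e > 0"
      then have "S - (e/2)\<^sup>2 < S" by simp
      then obtain p where p: "p \<in> C" "S - (e/2)\<^sup>2 < (norm (p y))\<^sup>2"
        unfolding S_def using less_cSup_iff[OF _ bdd] ne by blast
      have close: "dist (q y) (p y) < e / 2" if q: "q \<in> C" "q o\<^sub>L p = p" for q
      proof -
        have "(norm (q y))\<^sup>2 \<le> S"
          unfolding S_def using q by (intro cSup_upper bdd) blast
        then have "(norm (q y - p y))\<^sup>2 < (e/2)\<^sup>2"
          using projection_le_norm[OF proj[OF p(1)] proj[OF q(1)] q(2), of y] p(2) by simp
        then show ?thesis
          unfolding dist_norm by (rule power_less_imp_less_base) (use e in simp)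
      qed
      have "eventually (\<lambda>q. dist (a q y) (p y) < e / 2) F"
        unfolding ev using p(1) close by (auto simp: a_def)
      moreover have "dist (a q y) (a r y) < e"
        if "dist (a q y) (p y) < e / 2" "dist (a r y) (p y) < e / 2" for q r
        using that by (rule dist_triangle_half_l)
      ultimately show "\<exists>P. eventually P F \<and> (\<forall>q r. P q \<and> P r \<longrightarrow> dist (a q y) (a r y) < e)"
        by blast
    qed
    moreover have "complete (UNIV :: 'h set)"
      by (meson Cauchy_convergent UNIV_I complete_def convergent_def)
    ultimately show ?thesis
      using complete_uniform[where S = "UNIV :: 'h set"] F by (force simp add: filterlim_def filtermap_bot_iff)
  qed
  then obtain E where E: "\<And>y. ((\<lambda>q. a q y) \<longlongrightarrow> blinfun_apply E y) F"
    using strong_limit_exists[OF F, of a 1] a1 by blast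
  have "projection E"
    unfolding projection_def
  proof (intro conjI)
    show "E \<in> bounded_ops"
      by (rule strong_limit_bounded_ops[OF F _ E]) (use proj[OF aC] in \<open>simp add: projection_def\<close>)
    show "selfadjoint E"
      by (rule strong_limit_selfadjoint[OF F _ E]) (use proj[OF aC] in \<open>simp add: projection_def\<close>)
    show "E o\<^sub>L E = E"
    proof (rule blinfun_eqI)
      fix y
      have "((\<lambda>q. a q (a q y)) \<longlongrightarrow> E (E y)) F"
        by (rule strong_limit_compose[OF a1 E E])
      then show "(E o\<^sub>L E) y = E y"
        using E[of y] by (simp add: projection_apply_twice[OF proj[OF aC]] tendsto_unique[OF F])
    qed
  qed
  moreover have "E o\<^sub>L p = p" if p: "p \<in> C" for p
  proof (rule blinfun_eqI)
    fix y
    have "eventually (\<lambda>q. p y = a q (p y)) F"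
      unfolding ev using p by (intro bexI[of _ p]) (auto simp: a_def simp flip: blinfun_apply_blinfun_compose)
    then have "((\<lambda>q. a q (p y)) \<longlongrightarrow> p y) F"
      by (rule Lim_transform_eventually[OF tendsto_const])
    then show "(E o\<^sub>L p) y = p y"
      using tendsto_unique[OF F E] by simp
  qed
  moreover have "E \<in> J" if "closedin ultraweak_topology J" "C \<subseteq> J" for J
    using that aC by (intro ultraweakly_closed_strong_limit[OF that(1) F a1 _ E]) blast
  ultimately show ?thesis by blast
qed


section \<open>Invariant partial ideals\<close>

locale invariant_ideal = von_neumann A
  for A :: "('h::complex_hilbert_space \<Rightarrow>\<^sub>L 'h) set" +
  fixes \<pi> :: "('h \<Rightarrow>\<^sub>L 'h) set \<Rightarrow> ('h \<Rightarrow>\<^sub>L 'h) set"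
  assumes inv: "invariant_partial_ideal A \<pi>"
begin

lemma
  assumes V: "V \<in> comm_subalgebras A"
  shows ideal: "two_sided_ideal V (\<pi> V)" and closed: "closedin ultraweak_topology (\<pi> V)"
proof -
  have \<pi>: "\<pi> \<in> (\<Pi>\<^sub>E V \<in> comm_subalgebras A. {J. two_sided_ideal V J \<and> closedin ultraweak_topology J})"
    using inv by (simp add: invariant_partial_ideal_def partial_ideal_def)
  show "two_sided_ideal V (\<pi> V)" "closedin ultraweak_topology (\<pi> V)"
    using PiE_mem[OF \<pi> V] by simp_all
qed

lemma restrict: "V \<in> comm_subalgebras A \<Longrightarrow> W \<in> comm_subalgebras A \<Longrightarrow> V \<subseteq> W \<Longrightarrow> \<pi> V = \<pi> W \<inter> V"
  using inv unfolding invariant_partial_ideal_def partial_ideal_def by blast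

text \<open>Membership in the partial ideal without reference to a subalgebra. Sums and products in
  \<open>K\<close> are formed only inside a common commutative subalgebra.\<close>

definition K where "K = (\<Union>V\<in>comm_subalgebras A. \<pi> V)"

text \<open>Two subalgebras containing \<open>a\<close> are compared through their intersection, to
  which coherence applies from both sides.\<close>

lemma K_iff:
  assumes V: "V \<in> comm_subalgebras A" and a: "a \<in> V"
  shows "a \<in> K \<longleftrightarrow> a \<in> \<pi> V"
proof
  assume "a \<in> K"
  then obtain W where W: "W \<in> comm_subalgebras A" "a \<in> \<pi> W" unfolding K_def by blast
  have VW: "V \<inter> W \<in> comm_subalgebras A" by (rule comm_subalgebras_Int[OF V W(1)])
  have "a \<in> W" using W ideal unfolding two_sided_ideal_def by blast
  then have "a \<in> \<pi> (V \<inter> W)" using restrict[OF VW W(1)] W a by blast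
  then show "a \<in> \<pi> V" using restrict[OF VW V] by blast
next
  show "a \<in> \<pi> V \<Longrightarrow> a \<in> K" using V unfolding K_def by blast
qed

lemma K_subset: "K \<subseteq> A"
proof
  fix a assume "a \<in> K"
  then obtain V where V: "V \<in> comm_subalgebras A" "a \<in> \<pi> V" unfolding K_def by blast
  have "\<pi> V \<subseteq> V" using ideal[OF V(1)] by (simp add: two_sided_ideal_def)
  moreover have "V \<subseteq> A" using V(1) by (simp add: comm_subalgebras_def)
  ultimately show "a \<in> A" using V(2) by blast
qed

text \<open>The one place where invariance under unitaries enters.\<close>

lemma K_Ad:
  assumes a: "a \<in> K" and u: "u \<in> A" "unitary u"
  shows "Ad u a \<in> K"
proof -
  obtain V where V: "V \<in> comm_subalgebras A" "a \<in> \<pi> V" using a unfolding K_def by blast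
  have "Ad u ` \<pi> V = \<pi> (Ad u ` V)"
    using inv V(1) u unfolding invariant_partial_ideal_def by blast
  then have "Ad u a \<in> \<pi> (Ad u ` V)" using V(2) by blast
  then show ?thesis
    using Ad_comm_subalgebra[OF V(1) u] unfolding K_def by blast
qed

lemma zero_in_K: "0 \<in> K"
proof -
  obtain V where "V \<in> comm_subalgebras A"
    using comm_subalgebra_containing[of "{}"] by blast
  then show ?thesis using ideal unfolding K_def two_sided_ideal_def by blast
qed

text \<open>Commuting projections lie in one commutative subalgebra, where the value of the partial
  ideal is an honest ideal.\<close>

lemma K_projections:
  assumes p: "p \<in> K" "projection p" and q: "q \<in> A" "projection q"
    and pq: "p o\<^sub>L q = q o\<^sub>L p"
  shows K_compose: "p o\<^sub>L q \<in> K" and K_add: "q \<in> K \<Longrightarrow> p + q \<in> K"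
proof -
  have "\<exists>V\<in>comm_subalgebras A. {p, q} \<subseteq> V"
  proof (rule comm_subalgebra_containing)
    show "{p, q} \<subseteq> A" using p q K_subset by blast
    show "selfadjoint s" if "s \<in> {p, q}" for s
      using that p q by (auto simp: projection_def)
    show "s o\<^sub>L t = t o\<^sub>L s" if "s \<in> {p, q}" "t \<in> {p, q}" for s t
      using that pq by (metis insertE singletonD)
  qed
  then obtain V where V: "V \<in> comm_subalgebras A" "{p, q} \<subseteq> V" by blast
  have J: "two_sided_ideal V (\<pi> V)" by (rule ideal[OF V(1)])
  have "p \<in> \<pi> V" using K_iff[OF V(1)] p V(2) by blast
  then have "p o\<^sub>L q \<in> \<pi> V" using J V(2) unfolding two_sided_ideal_def by blast
  then show "p o\<^sub>L q \<in> K" using V(1) unfolding K_def by blast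
  assume "q \<in> K"
  then have "q \<in> \<pi> V" using K_iff[OF V(1)] V(2) by blast
  then have "p + q \<in> \<pi> V" using J \<open>p \<in> \<pi> V\<close> unfolding two_sided_ideal_def by blast
  then show "p + q \<in> K" using V(1) unfolding K_def by blast
qed

lemma maximal_projection:
  "\<exists>e\<in>K. projection e \<and> (\<forall>f\<in>K. projection f \<longrightarrow> f o\<^sub>L e = e \<longrightarrow> f = e)"
proof -
  define P where "P = {p \<in> K. projection p}"
  define le where "le p q \<longleftrightarrow> q o\<^sub>L p = p" for p q :: "'h \<Rightarrow>\<^sub>L 'h"
  have "\<exists>m\<in>P. \<forall>a\<in>P. le m a \<longrightarrow> a = m"
  proof (rule predicate_Zorn)
    have antisym: "p = q" if "p \<in> P" "q \<in> P" "le p q" "le q p" for p q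
    proof -
      have "p o\<^sub>L q = p"
        using that(1-3) unfolding P_def le_def by (blast intro: projection_le_commute)
      with that(4) show ?thesis unfolding le_def by metis
    qed
    show "partial_order_on P (relation_of le P)"
      by (rule partial_order_on_relation_ofI)
        (auto simp: le_def P_def projection_def intro: projection_le_trans antisym[unfolded P_def le_def])
  next
    fix C assume C: "C \<in> Chains (relation_of le P)"
    have CP: "C \<subseteq> P" using C by (auto simp: Chains_def relation_of_def)
    have chain: "q o\<^sub>L p = p \<or> p o\<^sub>L q = q" if "p \<in> C" "q \<in> C" for p q
      using C that by (auto simp: Chains_def relation_of_def le_def)
    show "\<exists>u\<in>P. \<forall>a\<in>C. le a u"
    proof (cases "C = {}")
      \<comment> \<open>The empty chain needs some upper bound, and 0 is a projection in
        \<open>K\<close>.\<close>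
      case True
      have "0 \<in> P"
        using zero_in_K bounded[OF zero_mem] by (auto simp: P_def projection_def selfadjoint_def intro: blinfun_eqI)
      with True show ?thesis by blast
    next
      case False
      have proj: "projection p" if "p \<in> C" for p using CP that by (auto simp: P_def)
      obtain E where E: "projection E" "\<And>p. p \<in> C \<Longrightarrow> E o\<^sub>L p = p"
        "\<And>J. closedin ultraweak_topology J \<Longrightarrow> C \<subseteq> J \<Longrightarrow> E \<in> J"
        using projection_chain_limit[OF False proj chain] by blast
      have CA: "C \<subseteq> A" using CP K_subset by (auto simp: P_def)
      \<comment> \<open>Members of a chain commute, so one commutative subalgebra contains them all;
        closedness of its ideal then captures the limit \<open>E\<close>.\<close>
      have "p o\<^sub>L q = q o\<^sub>L p" if "p \<in> C" "q \<in> C" for p q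
        using chain[OF that] projection_le_commute proj that by metis
      then obtain V where V: "V \<in> comm_subalgebras A" "C \<subseteq> V"
        using comm_subalgebra_containing[OF CA] proj unfolding projection_def by blast
      have "C \<subseteq> \<pi> V" using K_iff[OF V(1)] V(2) CP by (auto simp: P_def)
      then have "E \<in> \<pi> V" by (rule E(3)[OF closed[OF V(1)]])
      then have "E \<in> P" using E(1) V(1) by (auto simp: P_def K_def)
      with E(2) show ?thesis by (auto simp: le_def)
    qed
  qed
  then show ?thesis by (auto simp: P_def le_def)
qed

lemma central_support:
  "\<exists>e\<in>A. projection e \<and> (\<forall>a\<in>A. e o\<^sub>L a = a o\<^sub>L e)
    \<and> (\<forall>V\<in>comm_subalgebras A. \<pi> V = {a \<in> A. e o\<^sub>L a = a} \<inter> V)"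
proof -
  obtain e where e: "e \<in> K" "projection e"
    and max: "\<And>f. f \<in> K \<Longrightarrow> projection f \<Longrightarrow> f o\<^sub>L e = e \<Longrightarrow> f = e"
    using maximal_projection by blast
  have eA: "e \<in> A" using e K_subset by blast
  \<comment> \<open>The sum with \<open>e\<close> would be a projection in \<open>K\<close> above
    \<open>e\<close>, so maximality forces the summand to vanish.\<close>
  have orth: "q = 0" if q: "q \<in> K" "projection q" "e o\<^sub>L q = 0" "q o\<^sub>L e = 0" for q
  proof -
    have "e + q \<in> K"
      using q K_subset by (intro K_add e) auto
    moreover have "projection (e + q)"
      unfolding projection_def
    proof (intro conjI)
      show "e + q \<in> bounded_ops" using e q by (simp add: projection_def)
      show "selfadjoint (e + q)" using e q
        by (simp add: projection_def selfadjoint_def blinfun.bilinear_simps inner_add_left inner_add_right)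
      have "(e + q) o\<^sub>L (e + q) = (e o\<^sub>L e) + (q o\<^sub>L e) + (e o\<^sub>L q) + (q o\<^sub>L q)"
        by (rule blinfun_eqI) (simp add: blinfun.bilinear_simps)
      then show "(e + q) o\<^sub>L (e + q) = e + q" using e q by (simp add: projection_def)
    qed
    moreover have "(e + q) o\<^sub>L e = (e o\<^sub>L e) + (q o\<^sub>L e)"
      by (rule blinfun_eqI) (simp add: blinfun.bilinear_simps)
    then have "(e + q) o\<^sub>L e = e" using e q by (simp add: projection_def)
    ultimately have "e + q = e" by (rule max)
    then show ?thesis by simp
  qed
  have central: "e o\<^sub>L a = a o\<^sub>L e" if a: "a \<in> A" for a
  proof (rule ccontr)
    assume "e o\<^sub>L a \<noteq> a o\<^sub>L e"
    then obtain u q where u: "u \<in> A" "unitary u" and q: "q \<in> A" "projection q" "q \<noteq> 0"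
      "e o\<^sub>L q = q" "q o\<^sub>L e = q" and eAd: "e o\<^sub>L Ad u q = 0" "Ad u q o\<^sub>L e = 0"
      using noncentral_projection_swap[OF e(2) eA a] by blast
    have ub: "u \<in> bounded_ops" by (rule bounded[OF u(1)])
    note uu = unitary_adj_apply[OF u(2)]
    \<comment> \<open>Being below \<open>e\<close>, the projection \<open>q\<close> equals e
      q.\<close>
    have "q \<in> K" using K_compose[OF e q(1,2)] q by simp
    then have "Ad u q \<in> K" using u by (rule K_Ad)
    moreover have "projection (Ad u q)"
      unfolding projection_def
    proof (intro conjI)
      show "Ad u q \<in> bounded_ops" using q ub by (simp add: Ad_def projection_def)
      show "selfadjoint (Ad u q)"
        using q(2) by (simp add: selfadjoint_def Ad_apply projection_def inner_adj[OF ub] inner_adj'[OF ub])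
      show "Ad u q o\<^sub>L Ad u q = Ad u q"
        by (rule blinfun_eqI) (simp add: Ad_apply uu projection_apply_twice[OF q(2)])
    qed
    ultimately have "Ad u q = 0" using eAd by (rule orth)
    then have "u (q (adj u (u y))) = 0" for y by (simp flip: Ad_apply)
    then have "adj u (u (q y)) = adj u 0" for y by (simp add: uu)
    then have "q y = 0" for y by (simp add: uu blinfun.zero_right)
    then have "q = 0" by (intro blinfun_eqI) simp
    with q show False by simp
  qed
  \<comment> \<open>The product p (1 - e) is a projection in \<open>K\<close> orthogonal to
    \<open>e\<close>, hence zero.\<close>
  have below: "e o\<^sub>L p = p" if p: "p \<in> K" "projection p" for p
  proof -
    have pA: "p \<in> A" using p K_subset by blast
    have comm: "e (p y) = p (e y)" for y
      using central[OF pA] by (metis blinfun_apply_blinfun_compose)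
    define f where "f = id_blinfun - e"
    have f: "f y = y - e y" for y by (simp add: f_def blinfun.bilinear_simps)
    have ee: "e (e y) = e y" for y by (rule projection_apply_twice[OF e(2)])
    have pp: "p (p y) = p y" for y by (rule projection_apply_twice[OF p(2)])
    have "projection f"
      unfolding projection_def
    proof (intro conjI)
      show "f \<in> bounded_ops" unfolding f_def by (intro bounded diff_mem id_mem eA)
      show "selfadjoint f"
        using e(2) by (simp add: projection_def selfadjoint_def f inner_diff_left inner_diff_right)
      show "f o\<^sub>L f = f" by (rule blinfun_eqI) (simp add: f blinfun.bilinear_simps ee)
    qed
    moreover have "p o\<^sub>L f = f o\<^sub>L p"
      by (rule blinfun_eqI) (simp add: f blinfun.bilinear_simps comm)
    moreover have "f \<in> A" unfolding f_def by (intro diff_mem id_mem eA)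
    ultimately have "p o\<^sub>L f \<in> K" by (intro K_compose p)
    moreover have "projection (p o\<^sub>L f)"
      unfolding projection_def
    proof (intro conjI)
      show "p o\<^sub>L f \<in> bounded_ops"
        using p(2) \<open>projection f\<close> by (simp add: projection_def)
      show "selfadjoint (p o\<^sub>L f)"
        using p(2) e(2) by (simp add: projection_def selfadjoint_def f blinfun.bilinear_simps
            inner_diff_left inner_diff_right flip: comm)
      show "(p o\<^sub>L f) o\<^sub>L (p o\<^sub>L f) = p o\<^sub>L f"
        by (rule blinfun_eqI) (simp add: f blinfun.bilinear_simps comm pp ee)
    qed
    moreover have "e o\<^sub>L (p o\<^sub>L f) = 0" "(p o\<^sub>L f) o\<^sub>L e = 0"
      by (rule blinfun_eqI, simp add: f blinfun.bilinear_simps comm ee)+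
    ultimately have "p o\<^sub>L f = 0" by (rule orth)
    have "(p o\<^sub>L f) y = p y - e (p y)" for y
      by (simp add: f blinfun.bilinear_simps comm)
    then have "e (p y) = p y" for y using \<open>p o\<^sub>L f = 0\<close> by simp
    then show ?thesis by (intro blinfun_eqI) simp
  qed
  have "\<pi> V = {a \<in> A. e o\<^sub>L a = a} \<inter> V" if V: "V \<in> comm_subalgebras A" for V
  proof (intro equalityI subsetI)
    interpret V: von_neumann V
      by unfold_locales (use V in \<open>simp add: comm_subalgebras_def\<close>)
    have VA: "V \<subseteq> A" using V by (simp add: comm_subalgebras_def)
    fix a assume a: "a \<in> \<pi> V"
    then have aV: "a \<in> V" using ideal[OF V] unfolding two_sided_ideal_def by blast
    \<comment> \<open>The range projection taken inside \<open>V\<close> stays in the closed ideal,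
      so it lies in \<open>K\<close> and below \<open>e\<close>.\<close>
    obtain p where p: "projection p" "p o\<^sub>L a = a" "p \<in> \<pi> V"
      using V.range_projection[OF aV] ideal[OF V] closed[OF V] a by blast
    have "e o\<^sub>L p = p"
      using below p V unfolding K_def by blast
    then have "e o\<^sub>L a = a" using p(2) by (rule projection_le_trans)
    then show "a \<in> {a \<in> A. e o\<^sub>L a = a} \<inter> V" using aV VA by blast
  next
    interpret V: von_neumann V
      by unfold_locales (use V in \<open>simp add: comm_subalgebras_def\<close>)
    have VA: "V \<subseteq> A" using V by (simp add: comm_subalgebras_def)
    fix a assume a: "a \<in> {a \<in> A. e o\<^sub>L a = a} \<inter> V"
    \<comment> \<open>Conversely e a = a passes to the range projection, so p = e p lies in
      \<open>K\<close>, and a = p a.\<close>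
    then obtain p where p: "p \<in> V" "projection p" "p o\<^sub>L a = a" "e o\<^sub>L p = p"
      using V.range_projection[of a] by blast
    have pA: "p \<in> A" using p VA by blast
    have "e o\<^sub>L p \<in> K"
      by (rule K_compose[OF e pA p(2) central[OF pA]])
    then have "p \<in> \<pi> V" using K_iff[OF V p(1)] p(4) by simp
    then have "p o\<^sub>L a \<in> \<pi> V" using ideal[OF V] a unfolding two_sided_ideal_def by blast
    then show "a \<in> \<pi> V" by (simp add: p(3))
  qed
  then show ?thesis using eA e central by blast
qed

end


section \<open>Total ideals\<close>

text \<open>Moving \<open>e\<close> across the form makes the condition an equality of vector
  functionals of \<open>a\<close>.\<close>

lemma closedin_ultraweak_fixed:
  assumes e: "e \<in> bounded_ops"
  shows "closedin ultraweak_topology {a \<in> bounded_ops. e o\<^sub>L a = a}"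
proof -
  define M where "M x y = {a \<in> bounded_ops. cinner (blinfun_apply a x) (adj e y) = cinner (blinfun_apply a x) y}" for x y
  have "closedin ultraweak_topology (M x y)" for x y
    unfolding ultraweak_topology_def M_def
    by (rule closedin_op_topology_eq; rule ultraweak_vector_functional)
  then have "closedin ultraweak_topology (\<Inter>(x, y) \<in> UNIV. M x y)"
    by (intro closedin_Inter) auto
  also have "(\<Inter>(x, y) \<in> UNIV. M x y) = {a \<in> bounded_ops. e o\<^sub>L a = a}" (is "?L = ?R")
  proof (intro equalityI subsetI)
    fix a assume a: "a \<in> ?L"
    have "e (a x) = a x" for x
    proof (rule cinner_eq_imp_eq)
      fix y
      show "cinner (e (a x)) y = cinner (a x) y"
        using a cinner_adj[OF e, of "a x" y] by (auto simp: M_def)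
    qed
    then show "a \<in> ?R" using a by (auto simp: M_def intro: blinfun_eqI)
  next
    fix a assume a: "a \<in> ?R"
    then have "e (a x) = a x" for x by (metis (mono_tags, lifting) blinfun_apply_blinfun_compose mem_Collect_eq)
    then show "a \<in> ?L" using a cinner_adj[OF e] by (auto simp: M_def) metis
  qed
  finally show ?thesis .
qed

context von_neumann
begin

text \<open>Stability under left multiplication is where centrality enters: e a x = a e x = a
  x.\<close>

lemma total_ideal_corner:
  assumes e: "e \<in> A" and central: "\<And>a. a \<in> A \<Longrightarrow> e o\<^sub>L a = a o\<^sub>L e"
  shows "total_ideal A {a \<in> A. e o\<^sub>L a = a}"
  unfolding total_ideal_def
proof
  have "{a \<in> A. e o\<^sub>L a = a} = A \<inter> {a \<in> bounded_ops. e o\<^sub>L a = a}"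
    using bounded by blast
  then show "closedin ultraweak_topology {a \<in> A. e o\<^sub>L a = a}"
    using closedin_Int[OF ultraweakly_closed closedin_ultraweak_fixed[OF bounded[OF e]]] by simp
  have eb: "e \<in> bounded_ops" by (rule bounded[OF e])
  have "e o\<^sub>L (x + y) = (e o\<^sub>L x) + (e o\<^sub>L y)" "e o\<^sub>L scale_op c x = scale_op c (e o\<^sub>L x)" for x y c
    by (rule blinfun_eqI, simp add: blinfun.bilinear_simps scale_op.rep_eq bounded_opsD[OF eb])+
  moreover have "e o\<^sub>L (a o\<^sub>L x) = a o\<^sub>L x" if "e o\<^sub>L x = x" "a \<in> A" for a x
    using that central by (metis blinfun_compose_assoc)
  moreover have "e o\<^sub>L (x o\<^sub>L a) = x o\<^sub>L a" if "e o\<^sub>L x = x" for a x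
    using that by (simp flip: blinfun_compose_assoc)
  ultimately show "two_sided_ideal A {a \<in> A. e o\<^sub>L a = a}"
    unfolding two_sided_ideal_def by (auto simp: zero_mem add_mem scale_mem compose_mem)
qed

text \<open>The range projection of an element of \<open>I\<close> lies in \<open>I\<close> and,
  being selfadjoint, in some commutative subalgebra. It is therefore in \<open>J\<close>, and so is
  x = p x.\<close>

lemma total_ideal_subset_of_partial:
  assumes I: "total_ideal A I" and J: "total_ideal A J"
    and eq: "\<And>V. V \<in> comm_subalgebras A \<Longrightarrow> I \<inter> V \<subseteq> J"
  shows "I \<subseteq> J"
proof
  fix x assume x: "x \<in> I"
  then have xA: "x \<in> A" using I unfolding total_ideal_def two_sided_ideal_def by blast
  obtain p where p: "p \<in> A" "projection p" "p o\<^sub>L x = x" "p \<in> I"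
    using range_projection[OF xA] I x unfolding total_ideal_def by blast
  obtain V where "V \<in> comm_subalgebras A" "p \<in> V"
    using comm_subalgebra_containing[of "{p}"] p by (auto simp: projection_def)
  then have "p \<in> J" using eq p by blast
  then have "p o\<^sub>L x \<in> J" using J xA unfolding total_ideal_def two_sided_ideal_def by blast
  then show "x \<in> J" by (simp add: p(3))
qed

section \<open>The correspondence between total and invariant partial ideals\<close>

lemma invariant_partial_ideal_of:
  assumes I: "total_ideal A I"
  shows "invariant_partial_ideal A (partial_ideal_of A I)"
  unfolding invariant_partial_ideal_def partial_ideal_def
proof (intro conjI ballI impI)
  have I': "two_sided_ideal A I" "closedin ultraweak_topology I"
    using I by (simp_all add: total_ideal_def)
  have "two_sided_ideal V (I \<inter> V) \<and> closedin ultraweak_topology (I \<inter> V)"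
    if V: "V \<in> comm_subalgebras A" for V
  proof
    interpret V: von_neumann V
      by unfold_locales (use V in \<open>simp add: comm_subalgebras_def\<close>)
    have VA: "V \<subseteq> A" using V by (simp add: comm_subalgebras_def)
    show "two_sided_ideal V (I \<inter> V)"
      using I'(1) VA unfolding two_sided_ideal_def
      by (auto simp: V.zero_mem V.add_mem V.scale_mem V.compose_mem)
    show "closedin ultraweak_topology (I \<inter> V)"
      by (rule closedin_Int[OF I'(2) V.ultraweakly_closed])
  qed
  then show "partial_ideal_of A I \<in>
      (\<Pi>\<^sub>E V \<in> comm_subalgebras A. {J. two_sided_ideal V J \<and> closedin ultraweak_topology J})"
    unfolding partial_ideal_of_def by auto
  show "partial_ideal_of A I V = partial_ideal_of A I V' \<inter> V"
    if "V \<in> comm_subalgebras A" "V' \<in> comm_subalgebras A" "V \<subseteq> V'" for V V'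
    using that by (auto simp: partial_ideal_of_def)
  fix V u assume V: "V \<in> comm_subalgebras A" and u: "u \<in> A" "unitary u"
  have Ad_I: "Ad v a \<in> I" if "v \<in> A" "a \<in> I" for v a
    using that I'(1) adj_mem[OF that(1)] unfolding Ad_def two_sided_ideal_def by blast
  have ub: "u \<in> bounded_ops" by (rule bounded[OF u(1)])
  have "Ad (adj u) (Ad u a) = a" for a
    by (rule blinfun_eqI) (simp add: Ad_apply ub unitary_adj_apply[OF u(2)])
  then have "Ad u a \<in> I \<Longrightarrow> a \<in> I" for a
    using Ad_I[OF adj_mem[OF u(1)], of "Ad u a"] by simp
  \<comment> \<open>Conjugation by \<open>u\<close> and by its adjoint both preserve
    \<open>I\<close>, so \<open>Ad u a\<close> is in \<open>I\<close> exactly when \<open>a\<close>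
    is.\<close>
  then have "Ad u ` (I \<inter> V) = I \<inter> Ad u ` V"
    using Ad_I[OF u(1)] by blast
  then show "Ad u ` partial_ideal_of A I V = partial_ideal_of A I (Ad u ` V)"
    using V Ad_comm_subalgebra[OF V u] by (simp add: partial_ideal_of_def)
qed

lemma invariant_partial_idealE:
  assumes "invariant_partial_ideal A \<pi>"
  shows "\<exists>I. total_ideal A I \<and> \<pi> = partial_ideal_of A I"
proof -
  interpret invariant_ideal A \<pi> by unfold_locales (rule assms)
  obtain e where e: "e \<in> A" "\<And>a. a \<in> A \<Longrightarrow> e o\<^sub>L a = a o\<^sub>L e"
    and \<pi>: "\<And>V. V \<in> comm_subalgebras A \<Longrightarrow> \<pi> V = {a \<in> A. e o\<^sub>L a = a} \<inter> V"
    using central_support by blast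
  \<comment> \<open>Both sides take the same default value off the commutative subalgebras, so
    agreement on these is equality of functions.\<close>
  have "\<pi> \<in> extensional (comm_subalgebras A)"
    using assms unfolding invariant_partial_ideal_def partial_ideal_def PiE_def by blast
  then have "\<pi> = partial_ideal_of A {a \<in> A. e o\<^sub>L a = a}"
    unfolding partial_ideal_of_def
    by (rule extensionalityI[OF _ restrict_extensional]) (simp add: \<pi>)
  with total_ideal_corner[OF e] show ?thesis by blast
qed

lemma inj_on_partial_ideal_of: "inj_on (partial_ideal_of A) {I. total_ideal A I}"
proof (rule inj_onI)
  fix I J assume I: "I \<in> {I. total_ideal A I}" and J: "J \<in> {I. total_ideal A I}"
    and eq: "partial_ideal_of A I = partial_ideal_of A J"
  have "I \<inter> V = J \<inter> V" if "V \<in> comm_subalgebras A" for V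
    using fun_cong[OF eq, of V] that by (simp add: partial_ideal_of_def)
  then show "I = J"
    using I J total_ideal_subset_of_partial[of I J] total_ideal_subset_of_partial[of J I] by blast
qed

end

theorem theorem1p5:
  fixes A :: "('h::complex_hilbert_space \<Rightarrow>\<^sub>L 'h) set"
  assumes "von_neumann_algebra A"
  shows "(\<forall>\<pi>. partial_ideal A \<pi> \<longrightarrow>
            ((\<exists>I. total_ideal A I \<and> \<pi> = partial_ideal_of A I) \<longleftrightarrow> invariant_partial_ideal A \<pi>)) \<and>
         bij_betw (partial_ideal_of A) {I. total_ideal A I} {\<pi>. invariant_partial_ideal A \<pi>}"
proof -
  interpret von_neumann A by unfold_locales (rule assms)
  show ?thesis
    using invariant_partial_ideal_of invariant_partial_idealE inj_on_partial_ideal_of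
    unfolding bij_betw_def by blast
qed

end
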